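(* Let $Q$ be a finite quandle, let $\alpha: Tor(Z_0)\oplus Z_0/Tor(Z_0)\to Z_0$ be an isomorphism of groups, and let $G(Q)_\alpha$ and $\varphi_{Q,\alpha}:Q\to G(Q)_\alpha$ be the associated group and map. Then the irreducible quandle representations of $Q$ over $\mathbb{C}$ are exactly the representations of the form $\chi\cdot(\rho\circ\varphi_{Q,\alpha})$, where $\chi$ is a character of $Q$ and $\rho$ is an irreducible complex linear representation of the finite group $G(Q)_\alpha$.
   Context: A quandle is a set $Q$ with a binary operation $\triangleright$ such that $x\triangleright x=x$; $x\triangleright(y\triangleright z)=(x\triangleright y)\triangleright(x\triangleright z)$; and for all $x,y\in Q$ there is a unique $z\in Q$ with $x\triangleright z=y$. For $x\in Q$, $L_x:Q\to Q$ is the bijection $L_x(y)=x\triangleright y$; $Inn(Q)$ is the group of bijections of $Q$ generated by all $L_x$. The enveloping group is $G(Q)=\langle x\in Q\mid xyx^{-1}=x\triangleright y,\ x,y\in Q\rangle$, and $\varphi_Q:Q\to G(Q)$ sends $x$ to the corresponding generator. $\theta_{G(Q)}:G(Q)\to Inn(Q)$ is the surjective group morphism with $\theta_{G(Q)}(\varphi_Q(x))=L_x$, and $Z_0=\ker\theta_{G(Q)}$. It is known that $Z_0$ is contained in the center of $G(Q)$; for $Q$ finite, $Z_0$ is a finitely generated abelian group, with finite torsion subgroup $Tor(Z_0)$. Given an isomorphism $\alpha: Tor(Z_0)\oplus Z_0/Tor(Z_0)\to Z_0$, set $G(Q)_\alpha=G(Q)/\alpha(Z_0/Tor(Z_0))$,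 let $q_\alpha:G(Q)\to G(Q)_\alpha$ be the quotient map and $\varphi_{Q,\alpha}=q_\alpha\circ\varphi_Q$. A representation of $Q$ on a complex vector space $V$ is a map $\rho:Q\to GL(V)$ with $\rho(x\triangleright y)=\rho(x)\rho(y)\rho(x)^{-1}$. A subrepresentation is a subspace $W\subset V$ with $\rho(x)(W)\subset W$ for all $x\in Q$; $\rho$ is irreducible if $V\neq 0$ and its only subrepresentations are $0$ and $V$. A character of $Q$ is a map $\chi:Q\to\mathbb{C}^\times$ with $\chi(x\triangleright y)=\chi(y)$ for all $x,y\in Q$; $(\chi\cdot\rho)(x)=\chi(x)\rho(x)$. *)

theory Defs
  imports Complex_Main "HOL-Algebra.Generated_Groups" "HOL-Algebra.Bij"
begin

section \<open>Group presentations\<close>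

text \<open>
  The letter \<open>(True, x)\<close> stands for the generator \<open>x\<close> and \<open>(False, x)\<close> for its formal inverse.
  A relation is a pair of words that are to become equal.
\<close>

type_synonym 'a gword = "(bool \<times> 'a) list"

definition words :: "'a set \<Rightarrow> 'a gword set" where
  "words S = lists (UNIV \<times> S)"

inductive_set pres_rel :: "'a set \<Rightarrow> ('a gword \<times> 'a gword) set \<Rightarrow> ('a gword \<times> 'a gword) set"
  for S R where
    pres_refl: "w \<in> words S \<Longrightarrow> (w, w) \<in> pres_rel S R"
  | pres_sym: "(u, v) \<in> pres_rel S R \<Longrightarrow> (v, u) \<in> pres_rel S R"
  | pres_trans: "(u, v) \<in> pres_rel S R \<Longrightarrow> (v, w) \<in> pres_rel S R \<Longrightarrow> (u, w) \<in> pres_rel S R"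
  | pres_append: "(u, u') \<in> pres_rel S R \<Longrightarrow> (v, v') \<in> pres_rel S R
      \<Longrightarrow> (u @ v, u' @ v') \<in> pres_rel S R"
  | pres_cancel: "x \<in> S \<Longrightarrow> ([(b, x), (\<not> b, x)], []) \<in> pres_rel S R"
  | pres_relation: "(u, v) \<in> R \<Longrightarrow> u \<in> words S \<Longrightarrow> v \<in> words S \<Longrightarrow> (u, v) \<in> pres_rel S R"

definition presented_group ::
    "'a set \<Rightarrow> ('a gword \<times> 'a gword) set \<Rightarrow> 'a gword set monoid" where
  "presented_group S R =
    \<lparr>carrier = words S // pres_rel S R,
     mult = (\<lambda>A B. \<Union>u\<in>A. \<Union>v\<in>B. pres_rel S R `` {u @ v}),
     one = pres_rel S R `` {[]}\<rparr>"

definition pres_gen :: "'a set \<Rightarrow> ('a gword \<times> 'a gword) set \<Rightarrow> 'a \<Rightarrow> 'a gword set" where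
  "pres_gen S R x = pres_rel S R `` {[(True, x)]}"

definition word_eval :: "('g, 'm) monoid_scheme \<Rightarrow> ('a \<Rightarrow> 'g) \<Rightarrow> 'a gword \<Rightarrow> 'g" where
  "word_eval H f w = foldr (\<lambda>(b, x) h. (if b then f x else inv\<^bsub>H\<^esub> (f x)) \<otimes>\<^bsub>H\<^esub> h) w \<one>\<^bsub>H\<^esub>"

text \<open>
  The homomorphism out of a presented group induced by a map on generators, see
  \<open>pres_lift_hom\<close> and \<open>pres_lift_gen\<close>: all words in a class have the same value when
  the map respects the relations.
\<close>

definition pres_lift :: "('g, 'm) monoid_scheme \<Rightarrow> ('a \<Rightarrow> 'g) \<Rightarrow> 'a gword set \<Rightarrow> 'g" where
  "pres_lift H f A = the_elem (word_eval H f ` A)"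

lemma words_simps [simp]:
  "[] \<in> words S"
  "a # w \<in> words S \<longleftrightarrow> snd a \<in> S \<and> w \<in> words S"
  "u @ v \<in> words S \<longleftrightarrow> u \<in> words S \<and> v \<in> words S"
  by (cases a; auto simp: words_def)+

lemma pres_rel_words:
  assumes "(u, v) \<in> pres_rel S R" shows "u \<in> words S \<and> v \<in> words S"
  using assms by induction auto

lemma equiv_pres_rel: "equiv (words S) (pres_rel S R)"
  by (rule equivI)
    (auto simp: refl_on_def sym_def trans_def
      intro: pres_refl pres_sym pres_trans dest: pres_rel_words)

lemma pres_class_eqI: "(u, v) \<in> pres_rel S R \<Longrightarrow> pres_rel S R `` {u} = pres_rel S R `` {v}"
  using equiv_class_eq [OF equiv_pres_rel] .

lemma presented_group_mult:
  assumes "u \<in> words S" "v \<in> words S"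
  shows "pres_rel S R `` {u} \<otimes>\<^bsub>presented_group S R\<^esub> pres_rel S R `` {v} = pres_rel S R `` {u @ v}"
proof -
  have "pres_rel S R `` {u' @ v'} = pres_rel S R `` {u @ v}"
    if "u' \<in> pres_rel S R `` {u}" "v' \<in> pres_rel S R `` {v}" for u' v'
    using that by (intro pres_class_eqI pres_append) (simp_all add: pres_sym)
  then have "(\<Union>u'\<in>pres_rel S R `` {u}. \<Union>v'\<in>pres_rel S R `` {v}. pres_rel S R `` {u' @ v'})
      = (\<Union>u'\<in>pres_rel S R `` {u}. \<Union>v'\<in>pres_rel S R `` {v}. pres_rel S R `` {u @ v})"
    by (intro SUP_cong refl)
  moreover have "pres_rel S R `` {u} \<noteq> {}" "pres_rel S R `` {v} \<noteq> {}"
    using equiv_class_self [OF equiv_pres_rel] assms by blast+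
  ultimately show ?thesis
    by (simp add: presented_group_def)
qed

lemma pres_class_closed:
  "w \<in> words S \<Longrightarrow> pres_rel S R `` {w} \<in> carrier (presented_group S R)"
  by (simp add: presented_group_def quotientI)

lemma presented_groupE:
  assumes "A \<in> carrier (presented_group S R)"
  obtains w where "w \<in> words S" "A = pres_rel S R `` {w}"
  using assms by (auto simp: presented_group_def elim: quotientE)

lemma pres_gen_closed: "x \<in> S \<Longrightarrow> pres_gen S R x \<in> carrier (presented_group S R)"
  unfolding pres_gen_def by (rule pres_class_closed) simp

lemma presented_group_one: "\<one>\<^bsub>presented_group S R\<^esub> = pres_rel S R `` {[]}"
  by (simp add: presented_group_def)

lemma pres_left_inverse:
  "w \<in> words S \<Longrightarrow> \<exists>w' \<in> words S. (w' @ w, []) \<in> pres_rel S R"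
proof (induction w)
  case Nil
  show ?case by (rule bexI [of _ "[]"]) (auto intro: pres_refl)
next
  case (Cons a w)
  obtain b x where a: "a = (b, x)" by (cases a)
  with Cons.prems have x: "x \<in> S" and w: "w \<in> words S" by auto
  from Cons.IH [OF w] obtain w' where w': "w' \<in> words S" "(w' @ w, []) \<in> pres_rel S R" by blast
  have "([(\<not> b, x), (b, x)], []) \<in> pres_rel S R"
    using pres_cancel [OF x, of "\<not> b" R] by simp
  then have "(w' @ [(\<not> b, x), (b, x)] @ w, w' @ [] @ w) \<in> pres_rel S R"
    using w w'(1) by (intro pres_append pres_refl)
  with w'(2) have "((w' @ [(\<not> b, x)]) @ a # w, []) \<in> pres_rel S R"
    by (simp add: a) (rule pres_trans)
  with w'(1) x show ?case by (intro bexI [of _ "w' @ [(\<not> b, x)]"]) auto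
qed

theorem presented_group_group: "group (presented_group S R)"
proof (rule groupI)
  show "\<one>\<^bsub>presented_group S R\<^esub> \<in> carrier (presented_group S R)"
    unfolding presented_group_one by (rule pres_class_closed) simp
next
  fix A assume "A \<in> carrier (presented_group S R)"
  then obtain w where w: "w \<in> words S" "A = pres_rel S R `` {w}" by (rule presented_groupE)
  show "\<one>\<^bsub>presented_group S R\<^esub> \<otimes>\<^bsub>presented_group S R\<^esub> A = A"
    unfolding presented_group_one w(2) using w(1) by (subst presented_group_mult) auto
  obtain w' where w': "w' \<in> words S" "(w' @ w, []) \<in> pres_rel S R"
    using pres_left_inverse [OF w(1)] by blast
  show "\<exists>B\<in>carrier (presented_group S R). B \<otimes>\<^bsub>presented_group S R\<^esub> A = \<one>\<^bsub>presented_group S R\<^esub>"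
  proof
    show "pres_rel S R `` {w'} \<otimes>\<^bsub>presented_group S R\<^esub> A = \<one>\<^bsub>presented_group S R\<^esub>"
      unfolding presented_group_one w(2) presented_group_mult [OF w'(1) w(1)]
      by (rule pres_class_eqI [OF w'(2)])
  qed (rule pres_class_closed [OF w'(1)])
qed (auto elim!: presented_groupE simp: presented_group_mult pres_class_closed)

lemma word_eval_simps [simp]:
  "word_eval H f [] = \<one>\<^bsub>H\<^esub>"
  "word_eval H f ((b, x) # w) = (if b then f x else inv\<^bsub>H\<^esub> (f x)) \<otimes>\<^bsub>H\<^esub> word_eval H f w"
  by (simp_all add: word_eval_def)

context
  fixes H :: "('g, 'm) monoid_scheme" and f :: "'a \<Rightarrow> 'g" and S R
  assumes H: "group H" and f: "f \<in> S \<rightarrow> carrier H"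
    and R: "\<And>u v. (u, v) \<in> R \<Longrightarrow> u \<in> words S \<Longrightarrow> v \<in> words S \<Longrightarrow> word_eval H f u = word_eval H f v"
begin

interpretation H: group H by (rule H)

lemma word_eval_closed: "w \<in> words S \<Longrightarrow> word_eval H f w \<in> carrier H"
proof (induction w)
  case (Cons a w)
  then have "f (snd a) \<in> carrier H" "word_eval H f w \<in> carrier H" using f by auto
  then show ?case by (cases a) auto
qed simp

lemma word_eval_append:
  "u \<in> words S \<Longrightarrow> v \<in> words S \<Longrightarrow> word_eval H f (u @ v) = word_eval H f u \<otimes>\<^bsub>H\<^esub> word_eval H f v"
proof (induction u)
  case (Cons a u)
  then have "f (snd a) \<in> carrier H" "word_eval H f u \<in> carrier H" "word_eval H f v \<in> carrier H"
    using f word_eval_closed by auto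
  with Cons show ?case by (cases a) (auto simp: H.m_assoc)
qed (simp add: word_eval_closed)

lemma word_eval_cong: "(u, v) \<in> pres_rel S R \<Longrightarrow> word_eval H f u = word_eval H f v"
proof (induction rule: pres_rel.induct)
  case (pres_append u u' v v')
  then show ?case
    using pres_rel_words [of u u'] pres_rel_words [of v v'] by (simp add: word_eval_append)
next
  case (pres_cancel x b)
  then have "f x \<in> carrier H" using f by auto
  then show ?case by (cases b) auto
qed (use R in auto)

lemma pres_lift_class:
  assumes "w \<in> words S"
  shows "pres_lift H f (pres_rel S R `` {w}) = word_eval H f w"
proof -
  have "word_eval H f ` (pres_rel S R `` {w}) = {word_eval H f w}"
    using assms by (auto intro: pres_refl dest: word_eval_cong)
  then show ?thesis by (simp add: pres_lift_def)
qed

theorem pres_lift_hom: "pres_lift H f \<in> hom (presented_group S R) H"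
  by (rule homI)
    (auto elim!: presented_groupE
      simp: presented_group_mult pres_lift_class word_eval_closed word_eval_append)

theorem pres_lift_gen: "x \<in> S \<Longrightarrow> pres_lift H f (pres_gen S R x) = f x"
  using funcset_mem [OF f] by (simp add: pres_gen_def pres_lift_class)

end


section \<open>Quandles\<close>

definition quandle :: "'a set \<Rightarrow> ('a \<Rightarrow> 'a \<Rightarrow> 'a) \<Rightarrow> bool" where
  "quandle Q qop \<longleftrightarrow>
    (\<forall>x\<in>Q. \<forall>y\<in>Q. qop x y \<in> Q) \<and>
    (\<forall>x\<in>Q. qop x x = x) \<and>
    (\<forall>x\<in>Q. \<forall>y\<in>Q. \<forall>z\<in>Q. qop x (qop y z) = qop (qop x y) (qop x z)) \<and>
    (\<forall>x\<in>Q. \<forall>y\<in>Q. \<exists>!z. z \<in> Q \<and> qop x z = y)"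

definition left_mult :: "'a set \<Rightarrow> ('a \<Rightarrow> 'a \<Rightarrow> 'a) \<Rightarrow> 'a \<Rightarrow> 'a \<Rightarrow> 'a" where
  "left_mult Q qop x = (\<lambda>y\<in>Q. qop x y)"

definition Inn :: "'a set \<Rightarrow> ('a \<Rightarrow> 'a \<Rightarrow> 'a) \<Rightarrow> ('a \<Rightarrow> 'a) monoid" where
  "Inn Q qop = subgroup_generated (BijGroup Q) (left_mult Q qop ` Q)"

definition env_relations :: "'a set \<Rightarrow> ('a \<Rightarrow> 'a \<Rightarrow> 'a) \<Rightarrow> ('a gword \<times> 'a gword) set" where
  "env_relations Q qop =
    {([(True, x), (True, y), (False, x)], [(True, qop x y)]) | x y. x \<in> Q \<and> y \<in> Q}"

definition env_group :: "'a set \<Rightarrow> ('a \<Rightarrow> 'a \<Rightarrow> 'a) \<Rightarrow> 'a gword set monoid" where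
  "env_group Q qop = presented_group Q (env_relations Q qop)"

definition env_map :: "'a set \<Rightarrow> ('a \<Rightarrow> 'a \<Rightarrow> 'a) \<Rightarrow> 'a \<Rightarrow> 'a gword set" where
  "env_map Q qop = pres_gen Q (env_relations Q qop)"

definition theta :: "'a set \<Rightarrow> ('a \<Rightarrow> 'a \<Rightarrow> 'a) \<Rightarrow> 'a gword set \<Rightarrow> 'a \<Rightarrow> 'a" where
  "theta Q qop = pres_lift (Inn Q qop) (left_mult Q qop)"

definition Z0 :: "'a set \<Rightarrow> ('a \<Rightarrow> 'a \<Rightarrow> 'a) \<Rightarrow> 'a gword set monoid" where
  "Z0 Q qop = (env_group Q qop)
    \<lparr>carrier := kernel (env_group Q qop) (Inn Q qop) (theta Q qop)\<rparr>"

definition torsion_part :: "('g, 'm) monoid_scheme \<Rightarrow> 'g set" where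
  "torsion_part A = {a \<in> carrier A. \<exists>n::nat. n > 0 \<and> a [^]\<^bsub>A\<^esub> n = \<one>\<^bsub>A\<^esub>}"

definition Tor :: "('g, 'm) monoid_scheme \<Rightarrow> ('g, 'm) monoid_scheme" where
  "Tor A = A\<lparr>carrier := torsion_part A\<rparr>"

text \<open>
  Given an isomorphism \<open>\<alpha>\<close> from the direct sum of \<open>Tor A\<close> and \<open>A Mod torsion_part A\<close> to \<open>A\<close>,
  \<open>free_part A \<alpha>\<close> is the image of the second summand. For \<open>A = Z0 Q qop\<close>, the quotient of the
  enveloping group by it is written $G(Q)_\alpha$ in the literature (here \<open>finite_env_group\<close>,
  finite when \<open>Q\<close> is), and \<open>finite_env_map\<close> is the induced map from \<open>Q\<close> to it.
\<close>

definition free_part ::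
    "('g, 'm) monoid_scheme \<Rightarrow> ('g \<times> 'g set \<Rightarrow> 'g) \<Rightarrow> 'g set" where
  "free_part A \<alpha> = \<alpha> ` ({\<one>\<^bsub>A\<^esub>} \<times> carrier (A Mod torsion_part A))"

definition finite_env_group :: "'a set \<Rightarrow> ('a \<Rightarrow> 'a \<Rightarrow> 'a)
    \<Rightarrow> ('a gword set \<times> 'a gword set set \<Rightarrow> 'a gword set) \<Rightarrow> 'a gword set set monoid" where
  "finite_env_group Q qop \<alpha> = env_group Q qop Mod free_part (Z0 Q qop) \<alpha>"

definition finite_env_map :: "'a set \<Rightarrow> ('a \<Rightarrow> 'a \<Rightarrow> 'a)
    \<Rightarrow> ('a gword set \<times> 'a gword set set \<Rightarrow> 'a gword set) \<Rightarrow> 'a \<Rightarrow> 'a gword set set" where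
  "finite_env_map Q qop \<alpha> x = free_part (Z0 Q qop) \<alpha> #>\<^bsub>env_group Q qop\<^esub> env_map Q qop x"

lemma left_mult_Bij:
  assumes "quandle Q qop" "x \<in> Q"
  shows "left_mult Q qop x \<in> Bij Q"
proof -
  have closed: "\<And>y. y \<in> Q \<Longrightarrow> qop x y \<in> Q" and ex1: "\<And>y. y \<in> Q \<Longrightarrow> \<exists>!z. z \<in> Q \<and> qop x z = y"
    using assms unfolding quandle_def by blast+
  have "inj_on (qop x) Q"
    by (rule inj_onI) (metis closed ex1)
  moreover have "qop x ` Q = Q"
    using closed ex1 by blast
  ultimately have "bij_betw (qop x) Q Q"
    unfolding bij_betw_def by blast
  then show ?thesis
    by (auto simp: Bij_def left_mult_def)
qed

lemma Inn_group: "group (Inn Q qop)"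
  unfolding Inn_def by (rule group.group_subgroup_generated [OF group_BijGroup])

lemma left_mult_Inn:
  assumes "quandle Q qop" "x \<in> Q"
  shows "left_mult Q qop x \<in> carrier (Inn Q qop)"
  unfolding Inn_def carrier_subgroup_generated
  using left_mult_Bij [OF assms] assms(2)
  by (intro generate.incl) (auto simp: BijGroup_def)

lemma env_group_group: "group (env_group Q qop)"
  unfolding env_group_def by (rule presented_group_group)

lemma left_mult_conj:
  assumes q: "quandle Q qop" and x: "x \<in> Q" and y: "y \<in> Q"
  shows "left_mult Q qop (qop x y) \<otimes>\<^bsub>Inn Q qop\<^esub> left_mult Q qop x
    = left_mult Q qop x \<otimes>\<^bsub>Inn Q qop\<^esub> left_mult Q qop y"
proof -
  have closed: "\<And>x y. x \<in> Q \<Longrightarrow> y \<in> Q \<Longrightarrow> qop x y \<in> Q"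
    and dist: "\<And>x y z. x \<in> Q \<Longrightarrow> y \<in> Q \<Longrightarrow> z \<in> Q \<Longrightarrow> qop x (qop y z) = qop (qop x y) (qop x z)"
    using q unfolding quandle_def by blast+
  have "compose Q (left_mult Q qop (qop x y)) (left_mult Q qop x)
      = compose Q (left_mult Q qop x) (left_mult Q qop y)"
    using x y closed by (auto simp: compose_def left_mult_def fun_eq_iff dist [symmetric])
  then show ?thesis
    using left_mult_Bij [OF q] x y closed by (simp add: Inn_def subgroup_generated_def BijGroup_def)
qed

lemma
  assumes q: "quandle Q qop"
  shows theta_hom: "theta Q qop \<in> hom (env_group Q qop) (Inn Q qop)"
    and theta_env_map: "x \<in> Q \<Longrightarrow> theta Q qop (env_map Q qop x) = left_mult Q qop x"
proof -
  interpret I: group "Inn Q qop" by (rule Inn_group)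
  have closed: "\<And>x y. x \<in> Q \<Longrightarrow> y \<in> Q \<Longrightarrow> qop x y \<in> Q"
    using q unfolding quandle_def by blast
  have L: "left_mult Q qop \<in> Q \<rightarrow> carrier (Inn Q qop)"
    using left_mult_Inn [OF q] by blast
  have R: "word_eval (Inn Q qop) (left_mult Q qop) u = word_eval (Inn Q qop) (left_mult Q qop) v"
    if uv: "(u, v) \<in> env_relations Q qop" for u v
  proof -
    from uv obtain x y where xy: "x \<in> Q" "y \<in> Q"
      and [simp]: "u = [(True, x), (True, y), (False, x)]" "v = [(True, qop x y)]"
      by (auto simp: env_relations_def)
    have c: "left_mult Q qop x \<in> carrier (Inn Q qop)" "left_mult Q qop y \<in> carrier (Inn Q qop)"
      "left_mult Q qop (qop x y) \<in> carrier (Inn Q qop)"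
      using L xy closed by auto
    show ?thesis
      using c left_mult_conj [OF q xy] by (simp add: I.m_assoc [symmetric]) (metis I.inv_solve_right' I.m_closed)
  qed
  show "theta Q qop \<in> hom (env_group Q qop) (Inn Q qop)"
    unfolding theta_def env_group_def by (rule pres_lift_hom [OF Inn_group L R])
  show "theta Q qop (env_map Q qop x) = left_mult Q qop x" if "x \<in> Q"
    unfolding theta_def env_map_def by (rule pres_lift_gen [OF Inn_group L R that])
qed


section \<open>Complex representations\<close>

text \<open>
  A complex vector space is a type \<open>'v\<close> with a scalar multiplication satisfying
  \<open>vector_space scale\<close>. Its dimension is arbitrary.
\<close>

definition GL :: "(complex \<Rightarrow> 'v::ab_group_add \<Rightarrow> 'v) \<Rightarrow> ('v \<Rightarrow> 'v) monoid" where
  "GL scale = \<lparr>carrier = {f. Vector_Spaces.linear scale scale f \<and> bij f}, mult = (\<circ>), one = id\<rparr>"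

definition irreducible_on ::
    "(complex \<Rightarrow> 'v::ab_group_add \<Rightarrow> 'v) \<Rightarrow> 'x set \<Rightarrow> ('x \<Rightarrow> 'v \<Rightarrow> 'v) \<Rightarrow> bool" where
  "irreducible_on scale X \<rho> \<longleftrightarrow>
    (UNIV :: 'v set) \<noteq> {0} \<and>
    (\<forall>W. module.subspace scale W \<and> (\<forall>x\<in>X. \<rho> x ` W \<subseteq> W) \<longrightarrow> W = {0} \<or> W = UNIV)"

definition quandle_rep :: "'a set \<Rightarrow> ('a \<Rightarrow> 'a \<Rightarrow> 'a)
    \<Rightarrow> (complex \<Rightarrow> 'v::ab_group_add \<Rightarrow> 'v) \<Rightarrow> ('a \<Rightarrow> 'v \<Rightarrow> 'v) \<Rightarrow> bool" where
  "quandle_rep Q qop scale \<rho> \<longleftrightarrow>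
    \<rho> \<in> Q \<rightarrow> carrier (GL scale) \<and>
    (\<forall>x\<in>Q. \<forall>y\<in>Q. \<rho> (qop x y) = \<rho> x \<otimes>\<^bsub>GL scale\<^esub> \<rho> y \<otimes>\<^bsub>GL scale\<^esub> inv\<^bsub>GL scale\<^esub> (\<rho> x))"

definition irreducible_quandle_rep :: "'a set \<Rightarrow> ('a \<Rightarrow> 'a \<Rightarrow> 'a)
    \<Rightarrow> (complex \<Rightarrow> 'v::ab_group_add \<Rightarrow> 'v) \<Rightarrow> ('a \<Rightarrow> 'v \<Rightarrow> 'v) \<Rightarrow> bool" where
  "irreducible_quandle_rep Q qop scale \<rho> \<longleftrightarrow>
    quandle_rep Q qop scale \<rho> \<and> irreducible_on scale Q \<rho>"

definition irreducible_group_rep :: "('g, 'm) monoid_scheme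
    \<Rightarrow> (complex \<Rightarrow> 'v::ab_group_add \<Rightarrow> 'v) \<Rightarrow> ('g \<Rightarrow> 'v \<Rightarrow> 'v) \<Rightarrow> bool" where
  "irreducible_group_rep G scale \<rho> \<longleftrightarrow>
    \<rho> \<in> hom G (GL scale) \<and> irreducible_on scale (carrier G) \<rho>"

definition quandle_character :: "'a set \<Rightarrow> ('a \<Rightarrow> 'a \<Rightarrow> 'a) \<Rightarrow> ('a \<Rightarrow> complex) \<Rightarrow> bool" where
  "quandle_character Q qop \<chi> \<longleftrightarrow>
    (\<forall>x\<in>Q. \<chi> x \<noteq> 0) \<and> (\<forall>x\<in>Q. \<forall>y\<in>Q. \<chi> (qop x y) = \<chi> y)"

definition twist :: "(complex \<Rightarrow> 'v::ab_group_add \<Rightarrow> 'v)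
    \<Rightarrow> ('a \<Rightarrow> complex) \<Rightarrow> ('a \<Rightarrow> 'v \<Rightarrow> 'v) \<Rightarrow> 'a \<Rightarrow> 'v \<Rightarrow> 'v" where
  "twist scale \<chi> \<rho> x v = scale (\<chi> x) (\<rho> x v)"

lemma GL_group:
  fixes scale :: "complex \<Rightarrow> 'v::ab_group_add \<Rightarrow> 'v"
  assumes "vector_space scale"
  shows "group (GL scale)"
proof (rule groupI)
  show "\<one>\<^bsub>GL scale\<^esub> \<in> carrier (GL scale)"
    using assms by (simp add: GL_def Vector_Spaces.linear_iff)
next
  fix f assume "f \<in> carrier (GL scale)"
  then have f: "\<And>x y. f (x + y) = f x + f y" "\<And>c x. f (scale c x) = scale c (f x)" "bij f"
    by (auto simp: GL_def Vector_Spaces.linear_iff)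
  then have f_inv: "f (inv_into UNIV f x) = x" for x
    by (simp add: bij_is_surj surj_f_inv_f)
  have "Vector_Spaces.linear scale scale (inv_into UNIV f)"
    unfolding Vector_Spaces.linear_iff
    using assms by (auto intro!: inv_f_eq bij_is_inj [OF f(3)] simp: f(1,2) f_inv)
  with f(3) show "\<exists>g\<in>carrier (GL scale). g \<otimes>\<^bsub>GL scale\<^esub> f = \<one>\<^bsub>GL scale\<^esub>"
    by (intro bexI [of _ "inv_into UNIV f"]) (simp_all add: GL_def bij_imp_bij_inv bij_is_inj)
next
  fix f g assume "f \<in> carrier (GL scale)" "g \<in> carrier (GL scale)"
  then show "f \<otimes>\<^bsub>GL scale\<^esub> g \<in> carrier (GL scale)"
    by (simp add: GL_def Vector_Spaces.linear_iff bij_comp)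
qed (simp_all add: GL_def comp_assoc)

end

theory Submission
  imports Defs "HOL-Algebra.Multiplicative_Group"
    "HOL-Computational_Algebra.Fundamental_Theorem_Algebra"
    "HOL-Analysis.Continuum_Not_Denumerable"
begin

text \<open>
  Write \<open>G\<close> for the enveloping group, \<open>F\<close> for the free part of \<open>Z0\<close>, and \<open>K\<close> for the quotient of
  \<open>G\<close> by \<open>F\<close>. The group \<open>G\<close> acts on its generators by conjugation through \<open>theta\<close>, so \<open>Z0\<close> is
  central, and so is \<open>F\<close>.

  The quotient \<open>K\<close> is generated by the images of the elements of \<open>Q\<close>, a finite set that is stable
  under conjugation. They have finite order, because \<open>Inn Q\<close> is finite and \<open>Z0\<close> is torsion modulo
  \<open>F\<close>. By Dietzmann's lemma (\<open>finite_generate_torsion\<close>) \<open>K\<close> is finite.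

  A twist of an irreducible representation of \<open>K\<close> is irreducible on \<open>Q\<close>: in a finite group a
  subspace that is invariant under generators is invariant under the group
  (\<open>invariant_generate\<close>).

  Conversely, an irreducible representation \<open>\<sigma>\<close> of \<open>Q\<close> extends to \<open>G\<close>. Its dimension is not known
  to be finite, but it is countable, because \<open>Q\<close> is finite. Schur's lemma still holds in
  countable dimension over the complex numbers (\<open>schur_countable\<close>), so \<open>F\<close> acts by a character.
  This character extends to a character of \<open>G\<close> (\<open>mult_char_extend_central\<close>): the transfer from
  \<open>G\<close> to \<open>F\<close> restricts to the power map \<open>z \<mapsto> z\<^sup>n\<close> with \<open>n = order K\<close>, which is injective as \<open>F\<close> is
  torsion-free, and the nonzero complex numbers have all roots, so that characters extend
  along inclusions of abelian groups. The extension restricts to a quandle character \<open>\<chi>\<close>, and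
  \<open>\<chi>\<^sup>-\<^sup>1 \<sigma>\<close> factors through \<open>K\<close>.
\<close>

section \<open>Schur's lemma in countable dimension\<close>

text \<open>The vector \<open>p(T) v\<close>, for a polynomial \<open>p\<close> and an operator \<open>T\<close>, by Horner's scheme.\<close>

definition poly_op :: "('f::field \<Rightarrow> 'v::ab_group_add \<Rightarrow> 'v) \<Rightarrow> ('v \<Rightarrow> 'v) \<Rightarrow> 'f poly \<Rightarrow> 'v \<Rightarrow> 'v" where
  "poly_op scale T p v = fold_coeffs (\<lambda>a w. scale a v + T w) p 0"

context
  fixes scale :: "'f::field \<Rightarrow> 'v::ab_group_add \<Rightarrow> 'v" and T :: "'v \<Rightarrow> 'v"
  assumes vs: "vector_space scale" and T: "Vector_Spaces.linear scale scale T"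
begin

interpretation vector_space scale by (rule vs)
interpretation T: Vector_Spaces.linear scale scale T by (rule T)

lemma poly_op_0 [simp]: "poly_op scale T 0 v = 0"
  by (simp add: poly_op_def)

lemma poly_op_pCons [simp]: "poly_op scale T (pCons a p) v = scale a v + T (poly_op scale T p v)"
  by (cases "p = 0 \<and> a = 0") (auto simp: poly_op_def T.zero)

lemma poly_op_add: "poly_op scale T (p + q) v = poly_op scale T p v + poly_op scale T q v"
  by (induction p q rule: poly_induct2) (simp_all add: T.add scale_left_distrib algebra_simps)

lemma poly_op_smult: "poly_op scale T (smult c p) v = scale c (poly_op scale T p v)"
  by (induction p) (simp_all add: T.scale scale_right_distrib)

lemma poly_op_diff_left: "poly_op scale T p (u - v) = poly_op scale T p u - poly_op scale T p v"
  by (induction p) (simp_all add: T.diff scale_right_diff_distrib)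

lemma poly_op_scale: "poly_op scale T p (scale c v) = scale c (poly_op scale T p v)"
  by (induction p) (simp_all add: T.scale scale_right_distrib mult.commute)

lemma poly_op_commute: "poly_op scale T p (T v) = T (poly_op scale T p v)"
  by (induction p) (simp_all add: T.zero T.add T.scale)

lemma poly_op_linear_factor:
  "poly_op scale T ([:- a, 1:] * q) v = T (poly_op scale T q v) - scale a (poly_op scale T q v)"
proof -
  have "[:- a, 1:] * q = smult (- a) q + pCons 0 q" by simp
  then show ?thesis by (simp only: poly_op_add poly_op_smult poly_op_pCons) simp
qed

lemma poly_op_sum:
  "finite I \<Longrightarrow> poly_op scale T (\<Sum>i\<in>I. smult (c i) (p i)) v = (\<Sum>i\<in>I. scale (c i) (poly_op scale T (p i) v))"
  by (induction I rule: finite_induct) (simp_all add: poly_op_add poly_op_smult)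

end

lemma poly_op_nonzero:
  fixes scale :: "complex \<Rightarrow> 'v::ab_group_add \<Rightarrow> 'v"
  assumes vs: "vector_space scale" and T: "Vector_Spaces.linear scale scale T"
    and noeig: "\<And>a w. T w = scale a w \<Longrightarrow> w = 0"
  shows "p \<noteq> 0 \<Longrightarrow> v \<noteq> 0 \<Longrightarrow> poly_op scale T p v \<noteq> 0"
proof (induction "degree p" arbitrary: p)
  case 0
  interpret vector_space scale by (rule vs)
  interpret T: Vector_Spaces.linear scale scale T by (rule T)
  obtain c where "p = [:c:]" using "0.hyps" degree_0_id by metis
  with 0 show ?case by (simp add: poly_op_pCons [OF vs T] poly_op_0 [OF vs T] T.zero)
next
  case (Suc n)
  have "\<not> constant (poly p)" using Suc.hyps(2) by (simp add: constant_degree)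
  then obtain a where "poly p a = 0" using fundamental_theorem_of_algebra by blast
  then obtain q where q: "p = [:- a, 1:] * q" by (auto simp: poly_eq_0_iff_dvd)
  with Suc.prems have q0: "q \<noteq> 0" by auto
  have "degree p = Suc (degree q)" unfolding q using q0 by (subst degree_mult_eq) auto
  then have "poly_op scale T q v \<noteq> 0" using Suc q0 by auto
  then show ?case
    unfolding q poly_op_linear_factor [OF vs T] using noeig by (metis right_minus_eq)
qed

text \<open>
  When \<open>T\<close> has no eigenvector, \<open>p(T)\<close> is injective for every nonzero polynomial \<open>p\<close>.
  Multiplying a finite linear relation between the vectors \<open>(T - \<mu>)\<^sup>-\<^sup>1 v\<close> by the product of
  the \<open>T - \<mu>\<close> gives \<open>p(T) v = 0\<close>, where \<open>p\<close> takes a nonzero value at each \<open>\<mu>\<close> whose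
  coefficient in the relation is nonzero. So there is no nontrivial relation.
\<close>

lemma resolvent_independent:
  fixes scale :: "complex \<Rightarrow> 'v::ab_group_add \<Rightarrow> 'v"
  assumes vs: "vector_space scale" and T: "Vector_Spaces.linear scale scale T"
    and noeig: "\<And>a w. T w = scale a w \<Longrightarrow> w = 0"
    and u: "\<And>a. T (u a) - scale a (u a) = v" and v: "v \<noteq> 0"
  shows "inj u" and "\<not> module.dependent scale (range u)"
proof -
  interpret vector_space scale by (rule vs)
  interpret T: Vector_Spaces.linear scale scale T by (rule T)
  show inj: "inj u"
  proof (rule injI)
    fix a b assume eq: "u a = u b"
    have "scale a (u a) = scale b (u a)" using u [of a] u [of b] eq by (metis diff_add_cancel add_left_imp_eq diff_diff_eq2)
    moreover have "u a \<noteq> 0" using u [of a] v by (auto simp: T.zero)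
    ultimately show "a = b" by simp
  qed
  have relation: "c a = 0"
    if M: "finite M" and rel: "(\<Sum>a\<in>M. scale (c a) (u a)) = 0" and a: "a \<in> M" for M c a
  proof -
    define P where "P b = (\<Prod>d\<in>M - {b}. [:- d, 1:])" for b
    define R where "R = (\<Prod>d\<in>M. [:- d, 1:])"
    have R: "R = [:- b, 1:] * P b" if "b \<in> M" for b
      unfolding R_def P_def using M that by (rule prod.remove)
    have Ru: "poly_op scale T R (u b) = poly_op scale T (P b) v" if "b \<in> M" for b
    proof -
      have "poly_op scale T R (u b)
          = poly_op scale T (P b) (T (u b)) - poly_op scale T (P b) (scale b (u b))"
        unfolding R [OF that] poly_op_linear_factor [OF vs T] poly_op_commute [OF vs T]
          poly_op_scale [OF vs T] ..
      then show ?thesis by (simp only: poly_op_diff_left [OF vs T, symmetric] u)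
    qed
    define p where "p = (\<Sum>b\<in>M. smult (c b) (P b))"
    have lin: "poly_op scale T R (\<Sum>b\<in>M'. scale (c b) (u b)) = (\<Sum>b\<in>M'. scale (c b) (poly_op scale T R (u b)))"
      if "finite M'" for M' using that
    proof (induction M' rule: finite_induct)
      case empty
      show ?case using poly_op_scale [OF vs T, of R 0 0] by simp
    next
      case (insert b M')
      have "poly_op scale T R (x + y) = poly_op scale T R x + poly_op scale T R y" for x y
        using poly_op_diff_left [OF vs T, of R "x + y" y] by simp
      with insert show ?case by (simp add: poly_op_scale [OF vs T])
    qed
    have "poly_op scale T p v = (\<Sum>b\<in>M. scale (c b) (poly_op scale T R (u b)))"
      unfolding p_def poly_op_sum [OF vs T M] by (intro sum.cong refl) (simp add: Ru)
    also have "\<dots> = poly_op scale T R 0" using lin [OF M] rel by simp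
    also have "\<dots> = 0" using poly_op_scale [OF vs T, of R 0 0] by simp
    finally have "p = 0" using poly_op_nonzero [OF vs T, of p v] noeig v by blast
    moreover have "poly p a = c a * poly (P a) a"
    proof -
      have "poly (P b) a = 0" if "b \<in> M" "b \<noteq> a" for b
        unfolding P_def poly_prod using M a that by (intro prod_zero) auto
      then have "(\<Sum>b\<in>M. c b * poly (P b) a) = (\<Sum>b\<in>M. if b = a then c a * poly (P a) a else 0)"
        by (intro sum.cong) auto
      then show ?thesis using M a by (simp add: p_def poly_sum)
    qed
    moreover have "poly (P a) a \<noteq> 0" unfolding P_def poly_prod using M by auto
    ultimately show ?thesis by simp
  qed
  show "independent (range u)"
    unfolding independent_explicit_finite_subsets
  proof (intro allI impI ballI)
    fix S c w assume S: "S \<subseteq> range u" "finite S" "(\<Sum>x\<in>S. scale (c x) x) = 0" "w \<in> S"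
    define M where "M = u -` S"
    have SM: "S = u ` M" using S(1) by (auto simp: M_def)
    have M: "finite M" unfolding M_def using S(2) inj by (simp add: finite_vimageI)
    have "(\<Sum>a\<in>M. scale (c (u a)) (u a)) = 0"
      using S(3) unfolding SM by (subst (asm) sum.reindex) (use inj in \<open>auto intro: inj_on_subset\<close>)
    moreover obtain a where "a \<in> M" "w = u a" using S(4) SM by auto
    ultimately show "c w = 0" using relation [OF M, of "c \<circ> u" a] by simp
  qed
qed

lemma countable_independent:
  assumes "vector_space scale" "countable B" "module.span scale B = UNIV"
    and ind: "\<not> module.dependent scale S"
  shows "countable S"
proof -
  interpret vector_space scale by fact
  obtain e where e: "B \<subseteq> range (e :: nat \<Rightarrow> _)"
    using assms(2) by (metis range_from_nat_into empty_subsetI subset_refl)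
  have "S \<subseteq> (\<Union>n. S \<inter> span (e ` {..<n}))"
  proof
    fix s assume s: "s \<in> S"
    have "s \<in> span B" using assms(3) by simp
    then obtain t where t: "finite t" "t \<subseteq> B" "s \<in> span t"
      unfolding span_explicit by (auto intro: span_sum span_scale span_base)
    from t e obtain N where N: "finite N" "t = e ` N" by (meson finite_subset_image subset_trans)
    then obtain n where "N \<subseteq> {..<n}" by (meson finite_nat_iff_bounded)
    then have "s \<in> span (e ` {..<n})" using t N span_mono [of t "e ` {..<n}"] by blast
    with s show "s \<in> (\<Union>n. S \<inter> span (e ` {..<n}))" by blast
  qed
  moreover have "finite (S \<inter> span (e ` {..<n}))" for n
    using independent_span_bound [of "e ` {..<n}" "S \<inter> span (e ` {..<n})"]
      independent_mono [OF ind] by blast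
  then have "countable (\<Union>n. S \<inter> span (e ` {..<n}))"
    by (intro countable_UN [OF countableI_type] countable_finite)
  ultimately show ?thesis by (rule countable_subset)
qed

text \<open>
  Schur's lemma in the form of Dixmier: no dimension is assumed finite. The span of the vectors
  obtained from one \<open>v \<noteq> 0\<close> by applying words in the operators is invariant, so the space has
  countable dimension. If \<open>T\<close> were not scalar, then kernel and range of every \<open>T - a\<close> would
  be invariant, so every \<open>T - a\<close> would be bijective, and the vectors \<open>(T - a)\<^sup>-\<^sup>1 v\<close> would form
  an uncountable independent family.
\<close>

theorem schur_countable:
  fixes scale :: "complex \<Rightarrow> 'v::ab_group_add \<Rightarrow> 'v"
  assumes vs: "vector_space scale" and X: "countable X"
    and lin: "\<And>x. x \<in> X \<Longrightarrow> Vector_Spaces.linear scale scale (\<rho> x)"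
    and irr: "irreducible_on scale X \<rho>"
    and T: "Vector_Spaces.linear scale scale T"
    and comm: "\<And>x v. x \<in> X \<Longrightarrow> T (\<rho> x v) = \<rho> x (T v)"
  shows "\<exists>c. \<forall>v. T v = scale c v"
proof (rule ccontr)
  assume nonscalar: "\<not> (\<exists>c. \<forall>v. T v = scale c v)"
  interpret vector_space scale by (rule vs)
  interpret T: Vector_Spaces.linear scale scale T by (rule T)
  have invariant: "W = {0} \<or> W = UNIV"
    if "subspace W" "\<And>x w. x \<in> X \<Longrightarrow> w \<in> W \<Longrightarrow> \<rho> x w \<in> W" for W
    using irr that unfolding irreducible_on_def by blast
  have \<rho>: "\<rho> x (v + w) = \<rho> x v + \<rho> x w" "\<rho> x (v - w) = \<rho> x v - \<rho> x w"
      "\<rho> x (scale c v) = scale c (\<rho> x v)" "\<rho> x 0 = 0"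
    if "x \<in> X" for x v w c
  proof -
    interpret \<rho>: Vector_Spaces.linear scale scale "\<rho> x" by (rule lin [OF that])
    show "\<rho> x (v + w) = \<rho> x v + \<rho> x w" "\<rho> x (v - w) = \<rho> x v - \<rho> x w"
        "\<rho> x (scale c v) = scale c (\<rho> x v)" "\<rho> x 0 = 0"
      by (rule \<rho>.add \<rho>.diff \<rho>.scale \<rho>.zero)+
  qed
  have noeig: "w = 0" if "T w = scale a w" for a w
  proof -
    define W where "W = {w. T w = scale a w}"
    have "subspace W"
      unfolding subspace_def W_def by (auto simp: T.zero T.add T.scale scale_right_distrib)
    then have "W = {0} \<or> W = UNIV" by (rule invariant) (auto simp: W_def comm \<rho>)
    then show ?thesis using nonscalar that unfolding W_def by blast
  qed
  have onto: "\<exists>w. T w - scale a w = v" for a v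
  proof -
    define W where "W = range (\<lambda>w. T w - scale a w)"
    have "subspace W"
      unfolding W_def
    proof (rule subspaceI)
      show "0 \<in> range (\<lambda>w. T w - scale a w)" by (rule range_eqI [of _ _ 0]) (simp add: T.zero)
    next
      fix x y assume "x \<in> range (\<lambda>w. T w - scale a w)" "y \<in> range (\<lambda>w. T w - scale a w)"
      then obtain w w' where "x = T w - scale a w" "y = T w' - scale a w'" by blast
      then show "x + y \<in> range (\<lambda>w. T w - scale a w)"
        by (intro range_eqI [of _ _ "w + w'"]) (simp add: T.add scale_right_distrib)
    next
      fix c x assume "x \<in> range (\<lambda>w. T w - scale a w)"
      then obtain w where "x = T w - scale a w" by blast
      then show "scale c x \<in> range (\<lambda>w. T w - scale a w)"
        by (intro range_eqI [of _ _ "scale c w"])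
          (simp add: T.scale scale_right_diff_distrib mult.commute)
    qed
    moreover have "\<rho> x w \<in> W" if "x \<in> X" "w \<in> W" for x w
    proof -
      from that(2) obtain w' where "w = T w' - scale a w'" unfolding W_def by blast
      with that(1) show ?thesis
        unfolding W_def by (intro range_eqI [of _ _ "\<rho> x w'"]) (simp add: comm \<rho>)
    qed
    ultimately have "W = {0} \<or> W = UNIV" by (rule invariant)
    moreover have "W \<noteq> {0}"
    proof
      assume "W = {0}"
      then have "T w - scale a w = 0" for w unfolding W_def by blast
      with nonscalar show False by auto
    qed
    ultimately have "v \<in> W" by blast
    then show ?thesis unfolding W_def by blast
  qed
  obtain v :: 'v where v: "v \<noteq> 0"
    using irr unfolding irreducible_on_def by blast
  define u where "u a = (SOME w. T w - scale a w = v)" for a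
  have u: "T (u a) - scale a (u a) = v" for a
    unfolding u_def by (rule someI_ex [OF onto])
  define B where "B = (\<lambda>w. foldr \<rho> w v) ` lists X"
  have "span B = UNIV"
  proof -
    have "\<rho> x w \<in> span B" if x: "x \<in> X" and w: "w \<in> span B" for x w
      using w
    proof (induction rule: span_induct_alt)
      case (step c b y)
      have "\<rho> x b \<in> B"
        using step(1) x unfolding B_def by (auto simp: image_iff intro!: bexI [of _ "x # _"])
      then show ?case using step(2) x by (simp add: \<rho> span_add span_scale span_base)
    qed (use x in \<open>simp add: \<rho> span_zero\<close>)
    then have "span B = {0} \<or> span B = UNIV" by (intro invariant) auto
    moreover have "v \<in> span B" unfolding B_def by (intro span_base) (auto intro: image_eqI [of _ _ "[]"])
    ultimately show ?thesis using v by auto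
  qed
  moreover have "countable B" unfolding B_def using X by simp
  moreover have "independent (range u)"
    by (rule resolvent_independent(2) [OF vs T _ u v]) (rule noeig)
  ultimately have "countable (range u)"
    using countable_independent [OF vs] by blast
  moreover have "inj u"
    by (rule resolvent_independent(1) [OF vs T _ u v]) (rule noeig)
  ultimately have "countable (UNIV :: complex set)"
    by (rule countable_image_inj_on)
  then show False using uncountable_UNIV_complex by blast
qed

section \<open>Finite groups from torsion generators\<close>

text \<open>The ordered product of a list of group elements.\<close>

definition list_prod :: "('g, 'm) monoid_scheme \<Rightarrow> 'g list \<Rightarrow> 'g" where
  "list_prod G w = foldr (\<otimes>\<^bsub>G\<^esub>) w \<one>\<^bsub>G\<^esub>"

context group
begin

lemma list_prod_simps [simp]:
  "list_prod G [] = \<one>" "list_prod G (x # w) = x \<otimes> list_prod G w"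
  by (simp_all add: list_prod_def)

lemma list_prod_closed [simp]: "set w \<subseteq> carrier G \<Longrightarrow> list_prod G w \<in> carrier G"
  by (induction w) auto

lemma list_prod_append:
  "set u \<subseteq> carrier G \<Longrightarrow> set v \<subseteq> carrier G \<Longrightarrow>
    list_prod G (u @ v) = list_prod G u \<otimes> list_prod G v"
  by (induction u) (auto simp: m_assoc)

lemma list_prod_replicate: "x \<in> carrier G \<Longrightarrow> list_prod G (replicate k x) = x [^] k"
  by (induction k) (simp, metis replicate_Suc list_prod_simps(2) nat_pow_Suc2)

lemma list_prod_conj:
  assumes "set w \<subseteq> carrier G" "x \<in> carrier G"
  shows "x \<otimes> list_prod G w = list_prod G (map (\<lambda>y. x \<otimes> y \<otimes> inv x) w) \<otimes> x"
  using assms(1)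
proof (induction w)
  case (Cons y w)
  then have y: "y \<in> carrier G" and w: "set w \<subseteq> carrier G" by auto
  let ?w = "map (\<lambda>y. x \<otimes> y \<otimes> inv x) w"
  have w': "set ?w \<subseteq> carrier G" using w assms(2) by auto
  have "x \<otimes> list_prod G (y # w) = (x \<otimes> y \<otimes> inv x) \<otimes> (x \<otimes> list_prod G w)"
    using y w assms(2) by (simp add: m_assoc inv_solve_left)
  also have "\<dots> = (x \<otimes> y \<otimes> inv x) \<otimes> list_prod G ?w \<otimes> x"
    using Cons.IH [OF w] y w' assms(2) by (simp add: m_assoc)
  finally show ?case by simp
qed (use assms(2) in simp)

text \<open>
  Moving a letter to the right past others replaces these by conjugates, so all
  occurrences of \<open>x\<close> in a word can be collected at its end.
\<close>

lemma collect_letter: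
  assumes X: "X \<subseteq> carrier G" and conj: "\<And>x y. x \<in> X \<Longrightarrow> y \<in> X \<Longrightarrow> x \<otimes> y \<otimes> inv x \<in> X"
    and x: "x \<in> X" and w: "set w \<subseteq> X"
  shows "\<exists>w'. set w' \<subseteq> X \<and> length w' + count_list w x = length w \<and>
    list_prod G w = list_prod G w' \<otimes> x [^] count_list w x"
  using w
proof (induction w)
  case (Cons y w)
  then obtain w' where w': "set w' \<subseteq> X" "length w' + count_list w x = length w"
    "list_prod G w = list_prod G w' \<otimes> x [^] count_list w x" by auto
  have xG: "x \<in> carrier G" and yG: "y \<in> carrier G" and w'G: "set w' \<subseteq> carrier G"
    using x X w'(1) Cons.prems by auto
  show ?case
  proof (cases "y = x")
    case True
    let ?w = "map (\<lambda>y. x \<otimes> y \<otimes> inv x) w'"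
    have w: "set ?w \<subseteq> X" using w'(1) conj x by auto
    then have wG: "set ?w \<subseteq> carrier G" using X by blast
    have "list_prod G (y # w) = x \<otimes> list_prod G w' \<otimes> x [^] count_list w x"
      using True w'(3) xG w'G by (simp add: m_assoc)
    also have "\<dots> = list_prod G ?w \<otimes> x [^] Suc (count_list w x)"
      unfolding list_prod_conj [OF w'G xG]
      using list_prod_closed [OF wG] xG nat_pow_Suc2 [OF xG] by (simp add: m_assoc del: nat_pow_Suc)
    finally show ?thesis using w w'(2) True by (intro exI [of _ ?w]) simp
  next
    case False
    then show ?thesis
      using w' xG yG w'G Cons.prems by (intro exI [of _ "y # w'"]) (auto simp: m_assoc)
  qed
qed (auto intro: exI [of _ "[]"])

text \<open>
  Dietzmann's lemma: a finite set of torsion elements that is stable under conjugation by its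
  own elements generates a finite group. With a common exponent \<open>N\<close>, a word that has at least
  \<open>N\<close> occurrences of one letter can be shortened by collecting them and cancelling \<open>x [^] N\<close>,
  so words of length at most \<open>card X * N\<close> represent all elements.
\<close>

theorem finite_generate_torsion:
  assumes fin: "finite X" and X: "X \<subseteq> carrier G"
    and conj: "\<And>x y. x \<in> X \<Longrightarrow> y \<in> X \<Longrightarrow> x \<otimes> y \<otimes> inv x \<in> X"
    and torsion: "\<And>x. x \<in> X \<Longrightarrow> \<exists>n::nat. n > 0 \<and> x [^] n = \<one>"
  shows "finite (generate G X)"
proof -
  from torsion obtain e :: "_ \<Rightarrow> nat" where e: "\<And>x. x \<in> X \<Longrightarrow> e x > 0 \<and> x [^] e x = \<one>" by metis
  define N where "N = prod e X"
  have N: "N > 0" unfolding N_def using e by (simp add: prod_pos)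
  have xN: "x [^] N = \<one>" if "x \<in> X" for x
  proof -
    have "N = e x * prod e (X - {x})" unfolding N_def using fin that by (rule prod.remove)
    moreover have "x [^] (e x * prod e (X - {x})) = (x [^] e x) [^] prod e (X - {x})"
      using X that by (simp add: nat_pow_pow subset_iff)
    ultimately show ?thesis using e [OF that] by simp
  qed
  have short: "\<exists>w'. set w' \<subseteq> X \<and> length w' \<le> card X * N \<and> list_prod G w = list_prod G w'"
    if "set w \<subseteq> X" for w
    using that
  proof (induction "length w" arbitrary: w rule: less_induct)
    case less
    show ?case
    proof (cases "length w \<le> card X * N")
      case False
      have "\<exists>x\<in>X. count_list w x \<ge> N"
      proof (rule ccontr)
        assume "\<not> ?thesis"
        then have "(\<Sum>x\<in>X. count_list w x) \<le> (\<Sum>x\<in>X. N)" by (intro sum_mono) auto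
        with False show False using sum_count_set [OF less.prems fin] by simp
      qed
      then obtain x where x: "x \<in> X" "count_list w x \<ge> N" by blast
      obtain w' where w': "set w' \<subseteq> X" "length w' + count_list w x = length w"
        "list_prod G w = list_prod G w' \<otimes> x [^] count_list w x"
        using collect_letter [OF X conj x(1) less.prems] by blast
      define k where "k = count_list w x - N"
      have k: "count_list w x = N + k" using x(2) by (simp add: k_def)
      have xG: "x \<in> carrier G" and w'G: "set w' \<subseteq> carrier G" using x X w'(1) by auto
      have "x [^] (N + k) = x [^] k" using xN [OF x(1)] xG by (simp flip: nat_pow_mult)
      moreover have "set (replicate k x) \<subseteq> carrier G" using xG by auto
      ultimately have "list_prod G w = list_prod G (w' @ replicate k x)"
        using w'(3) xG w'G by (simp add: k list_prod_append list_prod_replicate)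
      moreover have "length (w' @ replicate k x) < length w" using w'(2) N k by simp
      moreover have "set (w' @ replicate k x) \<subseteq> X" using w'(1) x(1) by auto
      ultimately show ?thesis using less.hyps by metis
    qed (use less.prems in blast)
  qed
  have "\<exists>w. set w \<subseteq> X \<and> g = list_prod G w" if "g \<in> generate G X" for g
    using that
  proof (induction rule: generate.induct)
    case one
    show ?case by (intro exI [of _ "[]"]) simp
  next
    case (incl h)
    then show ?case using X by (intro exI [of _ "[h]"]) auto
  next
    case (inv h)
    then have h: "h \<in> carrier G" using X by blast
    have "h [^] (N - 1) \<otimes> h = \<one>" using xN [OF inv] N h by (simp flip: nat_pow_Suc)
    then have "inv h = h [^] (N - 1)" using h by (intro inv_equality) auto
    then show ?case
      using inv h by (intro exI [of _ "replicate (N - 1) h"]) (auto simp: list_prod_replicate)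
  next
    case (eng g h)
    then obtain u v where "set u \<subseteq> X" "g = list_prod G u" "set v \<subseteq> X" "h = list_prod G v" by blast
    then show ?case using X by (intro exI [of _ "u @ v"]) (auto simp: list_prod_append)
  qed
  then have "generate G X \<subseteq> list_prod G ` {w. set w \<subseteq> X \<and> length w \<le> card X * N}"
    using short by fastforce
  then show ?thesis using finite_lists_length_le [OF fin] finite_surj by blast
qed

end

section \<open>Transfer to a central subgroup\<close>

text \<open>
  The transfer to the kernel \<open>F\<close> of a surjective homomorphism \<open>q\<close> onto a finite group, when \<open>F\<close>
  is central. For a section \<open>s\<close> of \<open>q\<close>, it sends \<open>g\<close> to the product over all \<open>k\<close> of the elements
  \<open>s k \<otimes> g \<otimes> inv (s (k \<otimes> q g))\<close> of \<open>F\<close>.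
\<close>

lemma central_transfer:
  fixes G (structure) and K (structure)
  assumes hom: "group_hom G K q" and surj: "q ` carrier G = carrier K"
    and fin: "finite (carrier K)" and F: "kernel G K q = F"
    and central: "\<And>z g. z \<in> F \<Longrightarrow> g \<in> carrier G \<Longrightarrow> z \<otimes>\<^bsub>G\<^esub> g = g \<otimes>\<^bsub>G\<^esub> z"
  obtains V where "V \<in> hom G (G\<lparr>carrier := F\<rparr>)"
    "\<And>z. z \<in> F \<Longrightarrow> V z = z [^]\<^bsub>G\<^esub> Coset.order K"
proof -
  interpret G: group G by (rule group_hom.axioms(1) [OF hom])
  interpret K: group K by (rule group_hom.axioms(2) [OF hom])
  interpret q: group_hom G K q by (rule hom)
  have FG: "subgroup F G" using q.subgroup_kernel F by simp
  interpret F: subgroup F G by (rule FG)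
  let ?F = "G\<lparr>carrier := F\<rparr>"
  interpret Fg: comm_group ?F
    using G.subgroup_imp_group [OF FG] by (rule group.group_comm_groupI) (use central F.subset in auto)
  have F_iff: "z \<in> F \<longleftrightarrow> z \<in> carrier G \<and> q z = \<one>\<^bsub>K\<^esub>" for z
    using F by (auto simp: kernel_def)
  define s where "s = inv_into (carrier G) q"
  have s: "s k \<in> carrier G" "q (s k) = k" if "k \<in> carrier K" for k
    using that surj unfolding s_def by (auto intro: inv_into_into f_inv_into_f)
  define c where "c g k = s k \<otimes>\<^bsub>G\<^esub> g \<otimes>\<^bsub>G\<^esub> inv\<^bsub>G\<^esub> (s (k \<otimes>\<^bsub>K\<^esub> q g))" for g k
  have c_in: "c g k \<in> F" if "g \<in> carrier G" "k \<in> carrier K" for g k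
    unfolding c_def F_iff using that s by simp
  have c_mult: "c (g \<otimes>\<^bsub>G\<^esub> h) k = c g k \<otimes>\<^bsub>G\<^esub> c h (k \<otimes>\<^bsub>K\<^esub> q g)"
    if "g \<in> carrier G" "h \<in> carrier G" "k \<in> carrier K" for g h k
    unfolding c_def using that s by (simp add: G.m_assoc K.m_assoc G.inv_solve_left)
  define V where "V g = finprod ?F (c g) (carrier K)" for g
  have "V \<in> hom G ?F"
  proof (rule homI)
    fix g assume "g \<in> carrier G"
    then show "V g \<in> carrier ?F" unfolding V_def using c_in by (intro Fg.finprod_closed) auto
  next
    fix g h assume g: "g \<in> carrier G" and h: "h \<in> carrier G"
    have "inj_on (\<lambda>k. k \<otimes>\<^bsub>K\<^esub> q g) (carrier K)"
      using g by (intro K.inj_on_multc) simp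
    moreover from this have "(\<lambda>k. k \<otimes>\<^bsub>K\<^esub> q g) ` carrier K = carrier K"
      using g by (intro endo_inj_surj [OF fin]) auto
    ultimately have reindex: "V h = finprod ?F (\<lambda>k. c h (k \<otimes>\<^bsub>K\<^esub> q g)) (carrier K)"
      unfolding V_def
      using Fg.finprod_reindex [of "c h" "\<lambda>k. k \<otimes>\<^bsub>K\<^esub> q g" "carrier K"] c_in [OF h] by auto
    have "V (g \<otimes>\<^bsub>G\<^esub> h) = finprod ?F (\<lambda>k. c g k \<otimes>\<^bsub>?F\<^esub> c h (k \<otimes>\<^bsub>K\<^esub> q g)) (carrier K)"
      unfolding V_def using c_in g h by (intro Fg.finprod_cong') (auto simp: c_mult)
    also have "\<dots> = finprod ?F (c g) (carrier K) \<otimes>\<^bsub>?F\<^esub> finprod ?F (\<lambda>k. c h (k \<otimes>\<^bsub>K\<^esub> q g)) (carrier K)"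
      using c_in g h by (intro Fg.finprod_multf) auto
    finally show "V (g \<otimes>\<^bsub>G\<^esub> h) = V g \<otimes>\<^bsub>?F\<^esub> V h"
      unfolding reindex by (simp only: V_def)
  qed
  moreover have "V z = z [^]\<^bsub>G\<^esub> Coset.order K" if z: "z \<in> F" for z
  proof -
    have "c z k = z" if "k \<in> carrier K" for k
    proof -
      have "c z k = z \<otimes>\<^bsub>G\<^esub> s k \<otimes>\<^bsub>G\<^esub> inv\<^bsub>G\<^esub> (s k)"
        unfolding c_def using that z F_iff s central [OF z s(1) [OF that]] by simp
      then show ?thesis using that z F_iff s by (simp add: G.m_assoc)
    qed
    then have "V z = finprod ?F (\<lambda>k. z) (carrier K)"
      unfolding V_def using z by (intro Fg.finprod_cong') auto
    also have "\<dots> = z [^]\<^bsub>?F\<^esub> card (carrier K)" using z by (intro Fg.finprod_const) simp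
    finally show ?thesis by (simp add: Coset.order_def G.nat_pow_consistent [symmetric])
  qed
  ultimately show thesis by (rule that)
qed

section \<open>Extension of complex characters\<close>

text \<open>
  Multiplicative maps from a subset \<open>B\<close> of a group, usually a subgroup, to the nonzero complex
  numbers. The values of \<open>f\<close> outside \<open>B\<close> are irrelevant.
\<close>

definition mult_char :: "('g, 'm) monoid_scheme \<Rightarrow> 'g set \<Rightarrow> ('g \<Rightarrow> complex) \<Rightarrow> bool" where
  "mult_char G B f \<longleftrightarrow> (\<forall>x\<in>B. f x \<noteq> 0) \<and> (\<forall>x\<in>B. \<forall>y\<in>B. f (x \<otimes>\<^bsub>G\<^esub> y) = f x * f y)"

context group
begin

lemma
  assumes B: "subgroup B G" and f: "mult_char G B f"
  shows mult_char_one: "f \<one> = 1"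
    and mult_char_inv: "x \<in> B \<Longrightarrow> f (inv x) = inverse (f x)"
    and mult_char_int_pow: "x \<in> B \<Longrightarrow> f (x [^] (k::int)) = f x powi k"
proof -
  interpret B: subgroup B G by (rule B)
  have f0: "\<And>x. x \<in> B \<Longrightarrow> f x \<noteq> 0" and fm: "\<And>x y. x \<in> B \<Longrightarrow> y \<in> B \<Longrightarrow> f (x \<otimes> y) = f x * f y"
    using f by (auto simp: mult_char_def)
  show one: "f \<one> = 1" using f0 [of \<one>] fm [of \<one> \<one>] by simp
  show inv: "f (inv x) = inverse (f x)" if "x \<in> B" for x
    using fm [of x "inv x"] f0 [of x] that one by (simp add: inverse_unique)
  have pow: "x [^] (n::nat) \<in> B \<and> f (x [^] n) = f x ^ n" if "x \<in> B" for x n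
    using that by (induction n) (auto simp: one fm)
  show "f (x [^] (k::int)) = f x powi k" if "x \<in> B" for x k
  proof (cases "k \<ge> 0")
    case True
    then obtain n where "k = int n" by (rule nonneg_int_cases)
    then show ?thesis using pow [OF that, of n] by (simp only: int_pow_int power_int_of_nat)
  next
    case False
    define n where "n = nat (- k)"
    have k: "k = - int n" using False by (simp add: n_def)
    have "f (inv (x [^] n)) = inverse (f x ^ n)"
      using pow [OF that, of n] inv [of "x [^] n"] by simp
    moreover have "x [^] k = inv (x [^] n)"
      unfolding k using that by (subst int_pow_neg) (simp_all add: int_pow_int)
    ultimately show ?thesis by (simp only: k power_int_minus power_int_of_nat)
  qed
qed

end

text \<open>
  If \<open>m > 0\<close> is least with \<open>a [^] m \<in> B\<close>, then \<open>a\<close> is sent to an \<open>m\<close>-th root of the value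
  at \<open>a [^] m\<close>; if no such \<open>m\<close> exists, then any value will do.
\<close>

lemma (in comm_group) mult_char_extend_one:
  assumes B: "subgroup B G" and f: "mult_char G B f" and a: "a \<in> carrier G"
  shows "\<exists>B' f'. subgroup B' G \<and> insert a B \<subseteq> B' \<and> mult_char G B' f' \<and> (\<forall>x\<in>B. f' x = f x)"
proof -
  interpret B: subgroup B G by (rule B)
  have f0: "\<And>x. x \<in> B \<Longrightarrow> f x \<noteq> 0" and fm: "\<And>x y. x \<in> B \<Longrightarrow> y \<in> B \<Longrightarrow> f (x \<otimes> y) = f x * f y"
    using f by (auto simp: mult_char_def)
  have "\<exists>c. c \<noteq> 0 \<and> (\<forall>k::int. a [^] k \<in> B \<longrightarrow> f (a [^] k) = c powi k)"
  proof (cases "\<exists>m::nat. m > 0 \<and> a [^] m \<in> B")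
    case True
    define m where "m = (LEAST m::nat. m > 0 \<and> a [^] m \<in> B)"
    have m: "m > 0" "a [^] m \<in> B"
      using LeastI_ex [OF True] by (auto simp: m_def)
    have least: "m \<le> n" if "n > 0" "a [^] n \<in> B" for n :: nat
      unfolding m_def using that by (intro Least_le) auto
    have "card {z. z ^ m = f (a [^] m)} = m"
      using m f0 by (intro card_nth_roots) auto
    then have "{z. z ^ m = f (a [^] m)} \<noteq> {}" using m(1) by (metis card.empty less_irrefl)
    then obtain c where c: "c ^ m = f (a [^] m)" by blast
    have "c \<noteq> 0" using c f0 [OF m(2)] m(1) by (auto simp: power_0_left)
    moreover have "f (a [^] k) = c powi k" if k: "a [^] k \<in> B" for k :: int
    proof -
      define q r where "q = k div int m" and "r = nat (k mod int m)"
      have k_eq: "k = int m * q + int r" and r: "r < m"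
        using m(1) by (simp_all add: q_def r_def nat_less_iff)
      have "a [^] (int m * q) = (a [^] m) [^] q"
        using a by (simp add: int_pow_pow flip: int_pow_int)
      then have mq: "a [^] (int m * q) \<in> B" "f (a [^] (int m * q)) = c powi (int m * q)"
        using m(2) mult_char_int_pow [OF B f m(2), of q] c subgroup_int_pow_closed [OF B m(2)]
        by (simp_all add: power_int_mult)
      have "a [^] r = inv (a [^] (int m * q)) \<otimes> a [^] k"
        using a by (simp add: k_eq int_pow_mult m_assoc [symmetric] int_pow_int)
      then have "a [^] r \<in> B" using mq(1) k by simp
      then have "r = 0" using least [of r] r by fastforce
      with mq(2) k_eq show ?thesis by simp
    qed
    ultimately show ?thesis by blast
  next
    case False
    have zero: "k = 0" if "a [^] k \<in> B" for k :: int
    proof (rule ccontr)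
      assume "k \<noteq> 0"
      have "a [^] int (nat \<bar>k\<bar>) \<in> B"
        using that a B.m_inv_closed [OF that] by (cases "k \<ge> 0") (auto simp: int_pow_neg)
      then have "a [^] nat \<bar>k\<bar> \<in> B" by (simp only: int_pow_int)
      moreover have "nat \<bar>k\<bar> > 0" using \<open>k \<noteq> 0\<close> by simp
      ultimately show False using False by blast
    qed
    have "f (a [^] k) = 1 powi k" if "a [^] k \<in> B" for k :: int
      using zero [OF that] mult_char_one [OF B f] by simp
    then show ?thesis by (intro exI [of _ 1]) auto
  qed
  then obtain c where c0: "c \<noteq> 0" and c: "\<And>k::int. a [^] k \<in> B \<Longrightarrow> f (a [^] k) = c powi k" by blast
  define B' where "B' = {b \<otimes> a [^] k | b k::int. b \<in> B}"
  define f' where "f' y = (THE z. \<exists>b\<in>B. \<exists>k::int. y = b \<otimes> a [^] k \<and> z = f b * c powi k)" for y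
  have f': "f' (b \<otimes> a [^] k) = f b * c powi k" if b: "b \<in> B" for b and k :: int
    unfolding f'_def
  proof (rule the_equality)
    fix z assume "\<exists>b'\<in>B. \<exists>k'::int. b \<otimes> a [^] k = b' \<otimes> a [^] k' \<and> z = f b' * c powi k'"
    then obtain b' and k' :: int where b': "b' \<in> B" and eq: "b \<otimes> a [^] k = b' \<otimes> a [^] k'"
      and z: "z = f b' * c powi k'" by blast
    have bG: "b \<in> carrier G" "b' \<in> carrier G" using b b' by auto
    have "a [^] k = inv b \<otimes> (b' \<otimes> a [^] k')"
      unfolding eq [symmetric] using a bG by (simp add: m_assoc [symmetric])
    then have "a [^] (k - k') = inv b \<otimes> (b' \<otimes> a [^] k') \<otimes> inv (a [^] k')"
      using a by (simp add: int_pow_diff)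
    also have "\<dots> = inv b \<otimes> b'" using a bG by (simp add: m_assoc)
    finally have "a [^] (k - k') = inv b \<otimes> b'" .
    with c [of "k - k'"] b b' have "c powi (k - k') = inverse (f b) * f b'"
      by (simp add: fm mult_char_inv [OF B f])
    then have "f b' = f b * c powi (k - k')" using f0 [OF b] by simp
    then show "z = f b * c powi k"
      using c0 by (simp add: z flip: power_int_add)
  qed (use b in blast)
  have mult: "(b \<otimes> a [^] k) \<otimes> (b' \<otimes> a [^] k') = (b \<otimes> b') \<otimes> a [^] (k + k')"
    if "b \<in> B" "b' \<in> B" for b b' and k k' :: int
    using that a by (simp add: int_pow_mult m_ac)
  have "subgroup B' G"
  proof (rule subgroupI)
    show "B' \<subseteq> carrier G" unfolding B'_def using a by auto
    show "B' \<noteq> {}" unfolding B'_def using B.one_closed by blast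
  next
    fix x assume "x \<in> B'"
    then obtain b and k :: int where "b \<in> B" "x = b \<otimes> a [^] k" unfolding B'_def by blast
    then have "inv x = inv b \<otimes> a [^] (- k)" "inv b \<in> B"
      using a by (auto simp: inv_mult int_pow_neg)
    then show "inv x \<in> B'" unfolding B'_def by blast
  next
    fix x y assume "x \<in> B'" "y \<in> B'"
    then show "x \<otimes> y \<in> B'" unfolding B'_def using mult by (blast intro: B.m_closed)
  qed
  moreover have "b = b \<otimes> a [^] (0::int)" if "b \<in> B" for b using that by simp
  then have "B \<subseteq> B'" unfolding B'_def by blast
  moreover have "a = \<one> \<otimes> a [^] (1::int)" using a by (simp add: int_pow_1)
  then have "a \<in> B'" unfolding B'_def using B.one_closed by blast
  moreover have "mult_char G B' f'"
    unfolding mult_char_def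
  proof (intro conjI ballI)
    fix x assume "x \<in> B'"
    then show "f' x \<noteq> 0" unfolding B'_def using f0 c0 by (auto simp: f')
  next
    fix x y assume "x \<in> B'" "y \<in> B'"
    then obtain b b' and k k' :: int where b: "b \<in> B" "b' \<in> B"
      and xy: "x = b \<otimes> a [^] k" "y = b' \<otimes> a [^] k'" unfolding B'_def by blast
    have "f' (x \<otimes> y) = f (b \<otimes> b') * c powi (k + k')"
      unfolding xy mult [OF b] using b by (intro f') simp
    then show "f' (x \<otimes> y) = f' x * f' y"
      using b c0 by (simp add: xy f' fm power_int_add)
  qed
  moreover have "f' b = f b" if "b \<in> B" for b using f' [OF that, of 0] that by simp
  ultimately show ?thesis by (intro exI [of _ B'] exI [of _ f']) simp
qed

lemma (in comm_group) mult_char_extend_finite: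
  assumes "finite S" "S \<subseteq> carrier G" and B: "subgroup B G" and f: "mult_char G B f"
  shows "\<exists>B' f'. subgroup B' G \<and> S \<union> B \<subseteq> B' \<and> mult_char G B' f' \<and> (\<forall>x\<in>B. f' x = f x)"
  using assms(1,2)
proof (induction S rule: finite_induct)
  case empty
  then show ?case using B f by blast
next
  case (insert a S)
  then obtain B' f' where B': "subgroup B' G" "S \<union> B \<subseteq> B'" "mult_char G B' f'" "\<forall>x\<in>B. f' x = f x"
    by auto
  obtain B'' f'' where "subgroup B'' G" "insert a B' \<subseteq> B''" "mult_char G B'' f''" "\<forall>x\<in>B'. f'' x = f' x"
    using mult_char_extend_one [OF B'(1,3), of a] insert.prems by auto
  with B' show ?case by (intro exI [of _ B''] exI [of _ f'']) auto
qed

text \<open>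
  Characters of a torsion-free central subgroup of finite index in a finitely generated group
  extend to the group. With \<open>n\<close> the index of \<open>F\<close> and \<open>V\<close> the transfer, \<open>z [^] n \<mapsto> f z\<close> is well defined because
  \<open>F\<close> is torsion-free. It is extended from the \<open>n\<close>-th powers to the image of \<open>V\<close>, and then
  composed with \<open>V\<close>.
\<close>

theorem (in group) mult_char_extend_central:
  assumes hom: "group_hom G K q" and surj: "q ` carrier G = carrier K"
    and fin: "finite (carrier K)" and F: "kernel G K q = F"
    and central: "\<And>z g. z \<in> F \<Longrightarrow> g \<in> carrier G \<Longrightarrow> z \<otimes> g = g \<otimes> z"
    and torsion_free: "\<And>z n. z \<in> F \<Longrightarrow> n > 0 \<Longrightarrow> z [^] (n::nat) = \<one> \<Longrightarrow> z = \<one>"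
    and X: "finite X" "X \<subseteq> carrier G" "carrier G = generate G X"
    and f: "mult_char G F f"
  shows "\<exists>f'. mult_char G (carrier G) f' \<and> (\<forall>z\<in>F. f' z = f z)"
proof -
  interpret q: group_hom G K q by (rule hom)
  have FG: "subgroup F G" using q.subgroup_kernel F by simp
  interpret F: subgroup F G by (rule FG)
  let ?F = "G\<lparr>carrier := F\<rparr>"
  interpret Fg: comm_group ?F
    using subgroup_imp_group [OF FG] by (rule group.group_comm_groupI) (use central F.subset in auto)
  define n where "n = Coset.order K"
  have n: "n > 0" unfolding n_def using fin q.H.order_gt_0_iff_finite by blast
  obtain V where V: "V \<in> hom G ?F" and Vz: "\<And>z. z \<in> F \<Longrightarrow> V z = z [^] n"
    using central_transfer [OF hom surj fin F central] unfolding n_def by blast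
  interpret V: group_hom G ?F V by unfold_locales (rule V)
  define p where "p z = z [^] n" for z
  have p_mult: "p (x \<otimes> y) = p x \<otimes> p y" if "x \<in> F" "y \<in> F" for x y
    unfolding p_def using that central F.subset by (intro pow_mult_distrib) auto
  have p_closed: "p x \<in> F" if "x \<in> F" for x
    unfolding p_def using Fg.nat_pow_closed [of x n] that by (simp add: nat_pow_consistent [symmetric])
  have p_hom: "group_hom ?F ?F p"
    by unfold_locales (auto simp: hom_def p_mult p_closed)
  have p_inj: "inj_on p F"
    using group_hom.inj_on_one_iff [OF p_hom] torsion_free n by (auto simp: p_def)
  define B where "B = p ` F"
  have B: "subgroup B ?F"
    unfolding B_def using group_hom.img_is_subgroup [OF p_hom] by simp
  define g where "g y = f (inv_into F p y)" for y
  have g: "g (p z) = f z" if "z \<in> F" for z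
    unfolding g_def using p_inj that by simp
  have "g (p x \<otimes> p y) = f x * f y" if "x \<in> F" "y \<in> F" for x y
    using g [of "x \<otimes> y"] f that by (simp add: p_mult mult_char_def)
  then have "mult_char ?F B g"
    using f unfolding mult_char_def B_def by (auto simp: g)
  moreover have "finite (V ` X)" "V ` X \<subseteq> carrier ?F"
    using X(1,2) V.hom_closed by blast+
  ultimately obtain B' f' where B': "subgroup B' ?F" "V ` X \<union> B \<subseteq> B'" "mult_char ?F B' f'"
      "\<forall>x\<in>B. f' x = g x"
    using Fg.mult_char_extend_finite [OF _ _ B] by metis
  have VB': "V x \<in> B'" if "x \<in> generate G X" for x
    using that
  proof (induction rule: generate.induct)
    case one
    then show ?case using subgroup.one_closed [OF B'(1)] by simp
  next
    case (incl h)
    then show ?case using B'(2) by auto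
  next
    case (inv h)
    then have "h \<in> carrier G" "V h \<in> B'" using B'(2) X(2) by auto
    then show ?case using subgroup.m_inv_closed [OF B'(1)] by (metis V.hom_inv)
  next
    case (eng h1 h2)
    then have "h1 \<in> carrier G" "h2 \<in> carrier G" using X(3) by auto
    then show ?case using eng subgroup.m_closed [OF B'(1)] V.hom_mult by metis
  qed
  have "mult_char G (carrier G) (\<lambda>x. f' (V x))"
    using B'(3) VB' X(3) V.hom_mult by (auto simp: mult_char_def)
  moreover have "f' (V z) = f z" if "z \<in> F" for z
    using B'(4) Vz [OF that] g [OF that] that by (simp add: B_def p_def)
  ultimately show ?thesis by blast
qed

section \<open>The enveloping group and its finite quotient\<close>

lemma presented_group_generate:
  "carrier (presented_group S R) = generate (presented_group S R) (pres_gen S R ` S)"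
proof
  let ?P = "presented_group S R" and ?c = "\<lambda>w. pres_rel S R `` {w}"
  interpret P: group ?P by (rule presented_group_group)
  have gen: "pres_gen S R ` S \<subseteq> carrier ?P" by (auto intro: pres_gen_closed)
  show "generate ?P (pres_gen S R ` S) \<subseteq> carrier ?P" by (rule P.generate_incl [OF gen])
  have "?c w \<in> generate ?P (pres_gen S R ` S)" if "w \<in> words S" for w
    using that
  proof (induction w)
    case Nil
    show ?case using generate.one [of ?P] by (simp add: presented_group_one)
  next
    case (Cons a w)
    obtain b x where a: "a = (b, x)" by (cases a)
    with Cons.prems have x: "x \<in> S" and w: "w \<in> words S" by auto
    have letter: "?c [(b, x)] \<in> generate ?P (pres_gen S R ` S)"
    proof (cases b)
      case True
      then show ?thesis using x by (auto simp: pres_gen_def intro: generate.incl)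
    next
      case False
      have "?c [(False, x)] \<otimes>\<^bsub>?P\<^esub> ?c [(True, x)] = ?c ([(False, x)] @ [(True, x)])"
        using x by (intro presented_group_mult) simp_all
      also have "\<dots> = \<one>\<^bsub>?P\<^esub>"
        unfolding presented_group_one using pres_cancel [OF x, of False R]
        by (intro pres_class_eqI) simp
      finally have "inv\<^bsub>?P\<^esub> (pres_gen S R x) = ?c [(False, x)]"
        using x by (intro P.inv_equality) (auto simp: pres_gen_def intro: pres_class_closed)
      with False show ?thesis using x generate.inv [of "pres_gen S R x" "pres_gen S R ` S" ?P] by simp
    qed
    have "?c (a # w) = ?c [(b, x)] \<otimes>\<^bsub>?P\<^esub> ?c w"
      using presented_group_mult [of "[(b, x)]" S w R] x w a by simp
    then show ?case using generate.eng [OF letter Cons.IH [OF w]] by simp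
  qed
  then show "carrier ?P \<subseteq> generate ?P (pres_gen S R ` S)"
    by (auto elim!: presented_groupE)
qed

lemma env_map_closed: "x \<in> Q \<Longrightarrow> env_map Q qop x \<in> carrier (env_group Q qop)"
  unfolding env_map_def env_group_def by (rule pres_gen_closed)

lemma env_group_generate:
  "carrier (env_group Q qop) = generate (env_group Q qop) (env_map Q qop ` Q)"
  unfolding env_map_def env_group_def by (rule presented_group_generate)

lemma quandle_closed: "quandle Q qop \<Longrightarrow> x \<in> Q \<Longrightarrow> y \<in> Q \<Longrightarrow> qop x y \<in> Q"
  by (simp add: quandle_def)

lemma env_map_conj:
  assumes q: "quandle Q qop" and x: "x \<in> Q" and y: "y \<in> Q"
  shows "env_map Q qop x \<otimes>\<^bsub>env_group Q qop\<^esub> env_map Q qop y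
    = env_map Q qop (qop x y) \<otimes>\<^bsub>env_group Q qop\<^esub> env_map Q qop x"
proof -
  let ?R = "env_relations Q qop"
  let ?c = "\<lambda>w. pres_rel Q ?R `` {w}"
  have xy: "qop x y \<in> Q" by (rule quandle_closed [OF q x y])
  have "([(True, x), (True, y), (False, x)], [(True, qop x y)]) \<in> pres_rel Q ?R"
    using x y xy by (intro pres_relation) (auto simp: env_relations_def)
  then have "([(True, x), (True, y), (False, x)] @ [(True, x)], [(True, qop x y)] @ [(True, x)]) \<in> pres_rel Q ?R"
    using x by (intro pres_append pres_refl) simp_all
  moreover have "([(True, x), (True, y)] @ [(False, x), (True, x)], [(True, x), (True, y)] @ []) \<in> pres_rel Q ?R"
    using pres_cancel [OF x, of False ?R] x y by (intro pres_append pres_refl) simp_all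
  ultimately have "([(True, x), (True, y)], [(True, qop x y), (True, x)]) \<in> pres_rel Q ?R"
    by (auto intro: pres_trans pres_sym)
  then have "?c [(True, x), (True, y)] = ?c [(True, qop x y), (True, x)]"
    by (rule pres_class_eqI)
  then show ?thesis
    using x y xy presented_group_mult [of "[(True, x)]" Q "[(True, y)]" ?R]
      presented_group_mult [of "[(True, qop x y)]" Q "[(True, x)]" ?R]
    by (simp add: env_map_def env_group_def pres_gen_def)
qed

lemma Inn_carrier_subset:
  assumes "quandle Q qop"
  shows "carrier (Inn Q qop) \<subseteq> Bij Q"
  unfolding Inn_def using group.carrier_subgroup_generated_subset [OF group_BijGroup]
  by (fastforce simp: BijGroup_def)

lemma finite_Inn:
  assumes "quandle Q qop" "finite Q"
  shows "finite (carrier (Inn Q qop))"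
proof -
  have "Bij Q \<subseteq> Q \<rightarrow>\<^sub>E Q"
    by (auto simp: Bij_def PiE_def bij_betw_def)
  then have "finite (Bij Q)" using assms(2) by (metis finite_PiE finite_subset)
  then show ?thesis using Inn_carrier_subset [OF assms(1)] finite_subset by blast
qed

lemma Inn_mult:
  assumes "quandle Q qop" "f \<in> carrier (Inn Q qop)" "g \<in> carrier (Inn Q qop)" "x \<in> Q"
  shows "(f \<otimes>\<^bsub>Inn Q qop\<^esub> g) x = f (g x)"
proof -
  have "f \<in> Bij Q" "g \<in> Bij Q" using Inn_carrier_subset assms by blast+
  then show ?thesis using assms(4) by (simp add: Inn_def subgroup_generated_def BijGroup_def compose_def)
qed

lemma Inn_one: "x \<in> Q \<Longrightarrow> \<one>\<^bsub>Inn Q qop\<^esub> x = x"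
  by (simp add: Inn_def subgroup_generated_def BijGroup_def)

text \<open>The enveloping group acts on its generators by conjugation through \<open>theta\<close>.\<close>

lemma theta_conj:
  assumes q: "quandle Q qop" and g: "g \<in> carrier (env_group Q qop)" and x: "x \<in> Q"
  shows "g \<otimes>\<^bsub>env_group Q qop\<^esub> env_map Q qop x
    = env_map Q qop (theta Q qop g x) \<otimes>\<^bsub>env_group Q qop\<^esub> g"
proof -
  let ?G = "env_group Q qop" and ?\<phi> = "env_map Q qop" and ?\<theta> = "theta Q qop" and ?I = "Inn Q qop"
  interpret G: group ?G by (rule env_group_group)
  interpret I: group ?I by (rule Inn_group)
  interpret th: group_hom ?G ?I ?\<theta> by unfold_locales (rule theta_hom [OF q])
  have \<theta>Q: "?\<theta> g x \<in> Q" if "g \<in> carrier ?G" "x \<in> Q" for g x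
    using Inn_carrier_subset [OF q] th.hom_closed [OF that(1)] that(2)
    by (auto simp: Bij_def bij_betw_def)
  have \<theta>mult: "?\<theta> (g \<otimes>\<^bsub>?G\<^esub> h) x = ?\<theta> g (?\<theta> h x)"
    if "g \<in> carrier ?G" "h \<in> carrier ?G" "x \<in> Q" for g h x
    using that by (simp add: Inn_mult [OF q])
  have \<phi>: "?\<phi> x \<in> carrier ?G" if "x \<in> Q" for x by (rule env_map_closed [OF that])
  have "g \<in> generate ?G (?\<phi> ` Q)" using g env_group_generate by blast
  then have "\<forall>x\<in>Q. g \<otimes>\<^bsub>?G\<^esub> ?\<phi> x = ?\<phi> (?\<theta> g x) \<otimes>\<^bsub>?G\<^esub> g"
  proof (induction rule: generate.induct)
    case one
    show ?case using \<phi> by (simp add: Inn_one)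
  next
    case (incl h)
    then obtain y where y: "y \<in> Q" "h = ?\<phi> y" by blast
    then show ?case
      by (simp add: theta_env_map [OF q] left_mult_def env_map_conj [OF q])
  next
    case (inv h)
    then obtain y where y: "y \<in> Q" "h = ?\<phi> y" by blast
    then have h: "h \<in> carrier ?G" using \<phi> by simp
    show ?case
    proof
      fix x assume x: "x \<in> Q"
      let ?x = "?\<theta> (inv\<^bsub>?G\<^esub> h) x"
      have x': "?x \<in> Q" using h x by (intro \<theta>Q) simp_all
      have "?\<theta> h ?x = x" using \<theta>mult [of h "inv\<^bsub>?G\<^esub> h" x] h x by (simp add: Inn_one)
      moreover have "h \<otimes>\<^bsub>?G\<^esub> ?\<phi> ?x = ?\<phi> (?\<theta> h ?x) \<otimes>\<^bsub>?G\<^esub> h"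
        using y x' by (simp add: theta_env_map [OF q] left_mult_def env_map_conj [OF q])
      ultimately have eq: "h \<otimes>\<^bsub>?G\<^esub> ?\<phi> ?x = ?\<phi> x \<otimes>\<^bsub>?G\<^esub> h" by simp
      have "inv\<^bsub>?G\<^esub> h \<otimes>\<^bsub>?G\<^esub> ?\<phi> x = inv\<^bsub>?G\<^esub> h \<otimes>\<^bsub>?G\<^esub> (?\<phi> x \<otimes>\<^bsub>?G\<^esub> h) \<otimes>\<^bsub>?G\<^esub> inv\<^bsub>?G\<^esub> h"
        using h \<phi> [OF x] by (simp add: G.m_assoc)
      also have "\<dots> = ?\<phi> ?x \<otimes>\<^bsub>?G\<^esub> inv\<^bsub>?G\<^esub> h"
        using h \<phi> [OF x'] by (simp add: G.m_assoc [symmetric] flip: eq)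
      finally show "inv\<^bsub>?G\<^esub> h \<otimes>\<^bsub>?G\<^esub> ?\<phi> x = ?\<phi> ?x \<otimes>\<^bsub>?G\<^esub> inv\<^bsub>?G\<^esub> h" .
    qed
  next
    case (eng g h)
    then have g: "g \<in> carrier ?G" and h: "h \<in> carrier ?G" using env_group_generate by blast+
    show ?case
    proof
      fix x assume x: "x \<in> Q"
      have hx: "?\<theta> h x \<in> Q" using h x by (rule \<theta>Q)
      have "(g \<otimes>\<^bsub>?G\<^esub> h) \<otimes>\<^bsub>?G\<^esub> ?\<phi> x = (g \<otimes>\<^bsub>?G\<^esub> ?\<phi> (?\<theta> h x)) \<otimes>\<^bsub>?G\<^esub> h"
        using eng.IH(2) x g h \<phi> [OF x] \<phi> [OF hx] by (simp add: G.m_assoc)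
      also have "\<dots> = ?\<phi> (?\<theta> g (?\<theta> h x)) \<otimes>\<^bsub>?G\<^esub> (g \<otimes>\<^bsub>?G\<^esub> h)"
        using eng.IH(1) hx g h \<phi> [OF \<theta>Q [OF g hx]] by (simp add: G.m_assoc)
      finally show "(g \<otimes>\<^bsub>?G\<^esub> h) \<otimes>\<^bsub>?G\<^esub> ?\<phi> x = ?\<phi> (?\<theta> (g \<otimes>\<^bsub>?G\<^esub> h) x) \<otimes>\<^bsub>?G\<^esub> (g \<otimes>\<^bsub>?G\<^esub> h)"
        by (simp only: \<theta>mult [OF g h x])
    qed
  qed
  then show ?thesis using x by blast
qed

lemma (in group) commutes_generate:
  assumes X: "X \<subseteq> carrier G" and z: "z \<in> carrier G"
    and comm: "\<And>x. x \<in> X \<Longrightarrow> z \<otimes> x = x \<otimes> z" and g: "g \<in> generate G X"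
  shows "z \<otimes> g = g \<otimes> z"
  using g
proof (induction rule: generate.induct)
  case (inv h)
  then have h: "h \<in> carrier G" and zh: "z \<otimes> h = h \<otimes> z" using X comm by auto
  have "inv h \<otimes> z = inv h \<otimes> (z \<otimes> h) \<otimes> inv h" using h z by (simp add: m_assoc)
  also have "\<dots> = z \<otimes> inv h" unfolding zh using h z by (simp add: m_assoc [symmetric])
  finally show ?case ..
next
  case (eng g h)
  then have "g \<in> carrier G" "h \<in> carrier G" using generate_incl [OF X] by auto
  with eng.IH z show ?case by (metis m_assoc)
qed (use z comm in auto)

lemma Z0_central:
  assumes q: "quandle Q qop" and z: "z \<in> carrier (Z0 Q qop)" and g: "g \<in> carrier (env_group Q qop)"
  shows "z \<otimes>\<^bsub>env_group Q qop\<^esub> g = g \<otimes>\<^bsub>env_group Q qop\<^esub> z"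
proof -
  interpret G: group "env_group Q qop" by (rule env_group_group)
  have zG: "z \<in> carrier (env_group Q qop)" and "theta Q qop z = \<one>\<^bsub>Inn Q qop\<^esub>"
    using z by (auto simp: Z0_def kernel_def)
  then have "z \<otimes>\<^bsub>env_group Q qop\<^esub> env_map Q qop x = env_map Q qop x \<otimes>\<^bsub>env_group Q qop\<^esub> z"
    if "x \<in> Q" for x
    using theta_conj [OF q zG that] that by (simp add: Inn_one)
  moreover have "env_map Q qop ` Q \<subseteq> carrier (env_group Q qop)"
    by (auto intro: env_map_closed)
  moreover have "g \<in> generate (env_group Q qop) (env_map Q qop ` Q)"
    using g by (simp only: env_group_generate [symmetric])
  ultimately show ?thesis using G.commutes_generate [OF _ zG, of "env_map Q qop ` Q" g] by auto
qed

lemma Z0_subgroup: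
  assumes "quandle Q qop"
  shows "subgroup (carrier (Z0 Q qop)) (env_group Q qop)"
proof -
  interpret group_hom "env_group Q qop" "Inn Q qop" "theta Q qop"
    using env_group_group Inn_group theta_hom [OF assms] by (rule group_hom.intro [OF _ _ group_hom_axioms.intro])
  show ?thesis using subgroup_kernel by (simp add: Z0_def)
qed

lemma Z0_comm_group:
  assumes "quandle Q qop"
  shows "comm_group (Z0 Q qop)"
proof -
  have "group (Z0 Q qop)"
    using group.subgroup_imp_group [OF env_group_group Z0_subgroup [OF assms]] by (simp add: Z0_def)
  then show ?thesis
    using Z0_central [OF assms] subgroup.subset [OF Z0_subgroup [OF assms]]
    by (intro group.group_comm_groupI) (auto simp: Z0_def)
qed

lemma (in comm_group) torsion_part_subgroup: "subgroup (torsion_part G) G"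
proof (rule subgroupI)
  show "torsion_part G \<subseteq> carrier G" by (auto simp: torsion_part_def)
  have "\<one> \<in> torsion_part G" by (auto simp: torsion_part_def intro: exI [of _ "1::nat"])
  then show "torsion_part G \<noteq> {}" by blast
next
  fix a assume "a \<in> torsion_part G"
  then show "inv a \<in> torsion_part G" by (auto simp: torsion_part_def nat_pow_inv)
next
  fix a b assume "a \<in> torsion_part G" "b \<in> torsion_part G"
  then obtain m n :: nat where "m > 0" "n > 0" "a [^] m = \<one>" "b [^] n = \<one>"
    and ab: "a \<in> carrier G" "b \<in> carrier G" by (auto simp: torsion_part_def)
  have "a [^] (m * n) = \<one>"
    using nat_pow_pow [OF ab(1), of m n] \<open>a [^] m = \<one>\<close> by simp
  moreover have "b [^] (m * n) = \<one>"
    using nat_pow_pow [OF ab(2), of n m] \<open>b [^] n = \<one>\<close> by (simp add: mult.commute)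
  ultimately have "(a \<otimes> b) [^] (m * n) = \<one>" using ab by (simp add: nat_pow_distrib)
  moreover have "m * n > 0" using \<open>m > 0\<close> \<open>n > 0\<close> by simp
  ultimately show "a \<otimes> b \<in> torsion_part G" using ab unfolding torsion_part_def by blast
qed

text \<open>
  Under \<open>\<alpha>\<close> the free part corresponds to \<open>G Mod torsion_part G\<close>, which is torsion-free. A power
  that kills the torsion component of an element moves the element into the free part.
\<close>

lemma (in comm_group)
  assumes \<alpha>: "\<alpha> \<in> iso (Tor G \<times>\<times> (G Mod torsion_part G)) G"
  shows free_part_subgroup: "subgroup (free_part G \<alpha>) G"
    and free_part_torsion_free:
      "\<And>z n. z \<in> free_part G \<alpha> \<Longrightarrow> n > 0 \<Longrightarrow> z [^] (n::nat) = \<one> \<Longrightarrow> z = \<one>"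
    and free_part_pow: "\<And>a. a \<in> carrier G \<Longrightarrow> \<exists>n::nat. n > 0 \<and> a [^] n \<in> free_part G \<alpha>"
proof -
  let ?T = "torsion_part G"
  let ?M = "G Mod ?T" and ?D = "Tor G \<times>\<times> (G Mod ?T)"
  have T: "subgroup ?T G" by (rule torsion_part_subgroup)
  interpret T: subgroup ?T G by (rule T)
  interpret T: normal ?T G by (rule subgroup_imp_normal [OF T])
  have Tor: "group (Tor G)" unfolding Tor_def by (rule subgroup_imp_group [OF T])
  have M: "group ?M" by (rule T.factorgroup_is_group)
  interpret Tor: group "Tor G" by (rule Tor)
  interpret M: group ?M by (rule M)
  interpret D: group ?D by (rule DirProd_group [OF Tor M])
  interpret \<alpha>: group_hom ?D G \<alpha>
    using \<alpha> by unfold_locales (auto simp: iso_def)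
  have inj: "inj_on \<alpha> (carrier ?D)" and surj: "\<alpha> ` carrier ?D = carrier G"
    using \<alpha> by (auto simp: iso_def bij_betw_def)
  have oneT: "\<one>\<^bsub>Tor G\<^esub> = \<one>" by (simp add: Tor_def)
  have pow: "(t, c) [^]\<^bsub>?D\<^esub> n = (t [^]\<^bsub>Tor G\<^esub> n, c [^]\<^bsub>?M\<^esub> n)" for t c and n :: nat
    by (induction n) (simp_all del: mult_FactGroup one_FactGroup)
  have free: "z \<in> free_part G \<alpha> \<longleftrightarrow> (\<exists>c\<in>carrier ?M. z = \<alpha> (\<one>, c))" for z
    by (auto simp: free_part_def)
  have one_D: "(\<one>, c) \<in> carrier ?D" if "c \<in> carrier ?M" for c
    using that Tor.one_closed by (simp add: oneT)
  show "subgroup (free_part G \<alpha>) G"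
  proof -
    have "subgroup ({\<one>\<^bsub>Tor G\<^esub>} \<times> carrier ?M) ?D"
      by (rule DirProd_subgroups [OF Tor Tor.triv_subgroup M M.subgroup_self])
    then show ?thesis
      using \<alpha>.subgroup_img_is_subgroup by (simp add: free_part_def oneT)
  qed
  show "z = \<one>" if z: "z \<in> free_part G \<alpha>" and n: "n > 0" and zn: "z [^] (n::nat) = \<one>" for z n
  proof -
    obtain c where c: "c \<in> carrier ?M" "z = \<alpha> (\<one>, c)" using z free by blast
    have "\<alpha> ((\<one>, c) [^]\<^bsub>?D\<^esub> n) = \<alpha> \<one>\<^bsub>?D\<^esub>"
      using \<alpha>.hom_nat_pow [OF one_D [OF c(1)]] zn c(2) \<alpha>.hom_one by metis
    then have "(\<one>, c) [^]\<^bsub>?D\<^esub> n = \<one>\<^bsub>?D\<^esub>"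
      using inj D.nat_pow_closed [OF one_D [OF c(1)]] D.one_closed by (meson inj_onD)
    then have cn: "c [^]\<^bsub>?M\<^esub> n = \<one>\<^bsub>?M\<^esub>" unfolding pow one_DirProd by blast
    obtain a where a: "a \<in> carrier G" "c = ?T #> a"
      using c(1) by (auto simp: FactGroup_def RCOSETS_def)
    interpret q: group_hom G ?M "\<lambda>g. ?T #> g"
      by unfold_locales (rule T.r_coset_hom_Mod)
    have "?T #> (a [^] n) = ?T"
      using q.hom_nat_pow [OF a(1), of n] cn a(2) by simp
    then have "a [^] n \<in> ?T" using a(1) by (intro coset_join1 [OF _ _ T]) simp_all
    then obtain m :: nat where m: "m > 0" "(a [^] n) [^] m = \<one>"
      unfolding torsion_part_def by blast
    then have "a [^] (n * m) = \<one>" "n * m > 0" using a(1) n by (simp_all add: nat_pow_pow)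
    then have "a \<in> ?T" using a(1) unfolding torsion_part_def by blast
    then have "c = \<one>\<^bsub>?M\<^esub>" using a coset_join2 [OF a(1) T] by simp
    then show ?thesis using c(2) \<alpha>.hom_one by (simp add: oneT)
  qed
  show "\<exists>n::nat. n > 0 \<and> a [^] n \<in> free_part G \<alpha>" if a: "a \<in> carrier G" for a
  proof -
    have "a \<in> \<alpha> ` (?T \<times> carrier ?M)" using a surj by (simp add: Tor_def)
    then obtain t c where tc: "t \<in> ?T" "c \<in> carrier ?M" "a = \<alpha> (t, c)" by blast
    obtain n :: nat where n: "n > 0" "t [^] n = \<one>"
      using tc(1) unfolding torsion_part_def by blast
    have "t [^]\<^bsub>Tor G\<^esub> n = \<one>" using n(2) by (simp add: Tor_def nat_pow_consistent [symmetric])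
    moreover have tcD: "(t, c) \<in> carrier ?D" using tc by (simp add: Tor_def)
    ultimately have "a [^] n = \<alpha> (\<one>, c [^]\<^bsub>?M\<^esub> n)"
      using \<alpha>.hom_nat_pow [OF tcD, of n] by (simp only: pow tc(3))
    then show ?thesis using n(1) M.nat_pow_closed [OF tc(2), of n] free by blast
  qed
qed

text \<open>
  A finite quandle together with a splitting \<open>\<alpha>\<close> of \<open>Z0 Q qop\<close>. Here \<open>G\<close> is the enveloping
  group, \<open>F\<close> the free part of its central subgroup \<open>Z0 Q qop\<close>, \<open>K\<close> the quotient of \<open>G\<close> by \<open>F\<close>
  with projection \<open>proj\<close>, and \<open>\<phi>\<close> and \<open>\<psi>\<close> are the maps from \<open>Q\<close> to \<open>G\<close> and \<open>K\<close>.
\<close>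

locale finite_quandle =
  fixes Q :: "'a set" and qop :: "'a \<Rightarrow> 'a \<Rightarrow> 'a"
    and \<alpha> :: "'a gword set \<times> 'a gword set set \<Rightarrow> 'a gword set"
  assumes q: "quandle Q qop" and fin: "finite Q"
    and \<alpha>: "\<alpha> \<in> iso (Tor (Z0 Q qop) \<times>\<times> (Z0 Q qop Mod torsion_part (Z0 Q qop))) (Z0 Q qop)"
begin

abbreviation "G \<equiv> env_group Q qop"
abbreviation "\<phi> \<equiv> env_map Q qop"
abbreviation "F \<equiv> free_part (Z0 Q qop) \<alpha>"
abbreviation "K \<equiv> finite_env_group Q qop \<alpha>"
abbreviation "\<psi> \<equiv> finite_env_map Q qop \<alpha>"
abbreviation "proj \<equiv> \<lambda>g. F #>\<^bsub>G\<^esub> g"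

sublocale G: group G by (rule env_group_group)

lemma Z0_pow: "z [^]\<^bsub>Z0 Q qop\<^esub> (n::nat) = z [^]\<^bsub>G\<^esub> n"
  unfolding Z0_def by (rule G.nat_pow_consistent [symmetric])

lemma F_subset: "F \<subseteq> carrier (Z0 Q qop)"
  using comm_group.free_part_subgroup [OF Z0_comm_group [OF q] \<alpha>] subgroup.subset by blast

lemma F_subgroup: "subgroup F G"
  using G.incl_subgroup [OF Z0_subgroup [OF q]]
    comm_group.free_part_subgroup [OF Z0_comm_group [OF q] \<alpha>] by (simp add: Z0_def)

sublocale F: subgroup F G by (rule F_subgroup)

lemma F_central: "z \<in> F \<Longrightarrow> g \<in> carrier G \<Longrightarrow> z \<otimes>\<^bsub>G\<^esub> g = g \<otimes>\<^bsub>G\<^esub> z"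
  using Z0_central [OF q subsetD [OF F_subset]] .

lemma F_torsion_free: "z \<in> F \<Longrightarrow> n > 0 \<Longrightarrow> z [^]\<^bsub>G\<^esub> (n::nat) = \<one>\<^bsub>G\<^esub> \<Longrightarrow> z = \<one>\<^bsub>G\<^esub>"
  using comm_group.free_part_torsion_free [OF Z0_comm_group [OF q] \<alpha>, of z n]
  by (simp add: Z0_pow) (simp add: Z0_def)

lemma F_normal: "F \<lhd> G"
  using F_central F.subset by (intro G.normalI F_subgroup) (auto simp: r_coset_def l_coset_def)

sublocale F: normal F G by (rule F_normal)

lemma K_group: "group K"
  unfolding finite_env_group_def by (rule F.factorgroup_is_group)

sublocale K: group K by (rule K_group)

sublocale proj: group_hom G K proj
  by unfold_locales (use F.r_coset_hom_Mod in \<open>simp add: finite_env_group_def\<close>)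

lemma proj_surj: "proj ` carrier G = carrier K"
  by (auto simp: finite_env_group_def FactGroup_def RCOSETS_def)

lemma proj_kernel: "kernel G K proj = F"
  using G.coset_join1 [OF _ _ F_subgroup] G.coset_join2 [OF _ F_subgroup] F.subset
  by (auto simp: kernel_def finite_env_group_def)

lemma \<psi>: "\<psi> x = proj (\<phi> x)"
  by (simp add: finite_env_map_def)

lemma \<psi>_closed: "x \<in> Q \<Longrightarrow> \<psi> x \<in> carrier K"
  unfolding \<psi> by (rule proj.hom_closed [OF env_map_closed])

lemma \<psi>_conj:
  assumes "x \<in> Q" "y \<in> Q"
  shows "\<psi> x \<otimes>\<^bsub>K\<^esub> \<psi> y = \<psi> (qop x y) \<otimes>\<^bsub>K\<^esub> \<psi> x"
proof -
  have "\<phi> x \<in> carrier G" "\<phi> y \<in> carrier G" "\<phi> (qop x y) \<in> carrier G"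
    using assms quandle_closed [OF q assms] by (simp_all add: env_map_closed)
  then show ?thesis
    unfolding \<psi> by (metis proj.hom_mult env_map_conj [OF q assms])
qed

lemma K_generate: "carrier K = generate K (\<psi> ` Q)"
proof -
  have "generate K (proj ` (\<phi> ` Q)) = proj ` generate G (\<phi> ` Q)"
    by (rule proj.generate_img) (auto intro: env_map_closed)
  then show ?thesis
    unfolding env_group_generate [symmetric] proj_surj by (simp add: \<psi> image_image)
qed

text \<open>
  Some power of \<open>\<phi> x\<close> lies in \<open>Z0 Q qop\<close> because \<open>Inn Q qop\<close> is finite, and some further
  power lies in the free part.
\<close>

lemma \<phi>_pow:
  assumes x: "x \<in> Q"
  shows "\<exists>n::nat. n > 0 \<and> \<phi> x [^]\<^bsub>G\<^esub> n \<in> F"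
proof -
  interpret th: group_hom G "Inn Q qop" "theta Q qop"
    using Inn_group theta_hom [OF q] by (auto intro!: group_hom.intro group_hom_axioms.intro G.is_group)
  have x': "\<phi> x \<in> carrier G" by (rule env_map_closed [OF x])
  define m where "m = Coset.order (Inn Q qop)"
  have m: "m > 0" unfolding m_def using finite_Inn [OF q fin] by (simp add: th.H.order_gt_0_iff_finite)
  have "theta Q qop (\<phi> x [^]\<^bsub>G\<^esub> m) = \<one>\<^bsub>Inn Q qop\<^esub>"
    using th.hom_nat_pow [OF x'] th.H.pow_order_eq_1 [OF th.hom_closed [OF x']] by (simp add: m_def)
  then have "\<phi> x [^]\<^bsub>G\<^esub> m \<in> carrier (Z0 Q qop)" using x' by (simp add: Z0_def kernel_def)
  then obtain n :: nat where "n > 0" "(\<phi> x [^]\<^bsub>G\<^esub> m) [^]\<^bsub>G\<^esub> n \<in> F"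
    using comm_group.free_part_pow [OF Z0_comm_group [OF q] \<alpha>] unfolding Z0_pow by blast
  then show ?thesis using m x' by (intro exI [of _ "m * n"]) (simp add: G.nat_pow_pow)
qed

text \<open>
  The generators \<open>\<psi> x\<close> are permuted by conjugation and have finite order, so Dietzmann's lemma
  applies.
\<close>

lemma finite_K: "finite (carrier K)"
  unfolding K_generate
proof (rule K.finite_generate_torsion)
  show "finite (\<psi> ` Q)" using fin by simp
  show "\<psi> ` Q \<subseteq> carrier K" by (auto intro: \<psi>_closed)
next
  fix a b assume "a \<in> \<psi> ` Q" "b \<in> \<psi> ` Q"
  then obtain x y where xy: "x \<in> Q" "y \<in> Q" "a = \<psi> x" "b = \<psi> y" by blast
  have "a \<otimes>\<^bsub>K\<^esub> b \<otimes>\<^bsub>K\<^esub> inv\<^bsub>K\<^esub> a = \<psi> (qop x y)"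
    unfolding xy(3,4) \<psi>_conj [OF xy(1,2)]
    using xy(1,2) quandle_closed [OF q xy(1,2)] by (simp add: \<psi>_closed K.m_assoc)
  then show "a \<otimes>\<^bsub>K\<^esub> b \<otimes>\<^bsub>K\<^esub> inv\<^bsub>K\<^esub> a \<in> \<psi> ` Q" using xy quandle_closed [OF q] by simp
next
  fix a assume "a \<in> \<psi> ` Q"
  then obtain x where x: "x \<in> Q" "a = \<psi> x" by blast
  obtain n :: nat where n: "n > 0" "\<phi> x [^]\<^bsub>G\<^esub> n \<in> F" using \<phi>_pow [OF x(1)] by blast
  have pow: "\<psi> x [^]\<^bsub>K\<^esub> n = proj (\<phi> x [^]\<^bsub>G\<^esub> n)"
    unfolding \<psi> by (rule proj.hom_nat_pow [symmetric, OF env_map_closed [OF x(1)]])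
  have "\<phi> x [^]\<^bsub>G\<^esub> n \<in> kernel G K proj" using n(2) by (simp only: proj_kernel)
  then have "proj (\<phi> x [^]\<^bsub>G\<^esub> n) = \<one>\<^bsub>K\<^esub>" by (simp only: kernel_def mem_Collect_eq)
  then have "\<psi> x [^]\<^bsub>K\<^esub> n = \<one>\<^bsub>K\<^esub>" by (simp only: pow)
  then show "\<exists>n::nat. n > 0 \<and> a [^]\<^bsub>K\<^esub> n = \<one>\<^bsub>K\<^esub>" using n(1) x(2) by blast
qed

end

section \<open>Irreducible representations\<close>

lemma GL_mult [simp]: "f \<otimes>\<^bsub>GL scale\<^esub> g = f \<circ> g"
  by (simp add: GL_def)

lemma GL_one [simp]: "\<one>\<^bsub>GL scale\<^esub> = id"
  by (simp add: GL_def)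

lemma GL_carrier: "f \<in> carrier (GL scale) \<longleftrightarrow> Vector_Spaces.linear scale scale f \<and> bij f"
  by (simp add: GL_def)

lemma GL_scale:
  fixes scale :: "complex \<Rightarrow> 'v::ab_group_add \<Rightarrow> 'v"
  assumes vs: "vector_space scale" and c: "c \<noteq> 0" and f: "f \<in> carrier (GL scale)"
  shows "(\<lambda>v. scale c (f v)) \<in> carrier (GL scale)"
proof -
  interpret vector_space scale by (rule vs)
  have f': "Vector_Spaces.linear scale scale f" "bij f" using f by (auto simp: GL_carrier)
  have "bij (scale c)"
    by (rule bij_betw_byWitness [where f' = "scale (inverse c)"]) (use c in auto)
  then have "bij (\<lambda>v. scale c (f v))" using bij_comp [OF f'(2)] by (simp add: comp_def)
  moreover have "Vector_Spaces.linear scale scale (\<lambda>v. scale c (f v))"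
    using f'(1) unfolding Vector_Spaces.linear_iff
    by (simp add: scale_right_distrib mult.commute)
  ultimately show ?thesis by (simp add: GL_carrier)
qed

text \<open>In a finite group inverses are powers, so invariance can be tested on generators.\<close>

lemma invariant_generate:
  assumes G: "group G" and fin: "finite (carrier G)"
    and \<rho>: "\<rho> \<in> hom G (GL scale)" and X: "X \<subseteq> carrier G"
    and inv: "\<And>x. x \<in> X \<Longrightarrow> \<rho> x ` W \<subseteq> W" and vs: "vector_space scale"
    and g: "g \<in> generate G X"
  shows "\<rho> g ` W \<subseteq> W"
proof -
  interpret group G by (rule G)
  interpret \<rho>: group_hom G "GL scale" \<rho>
    using \<rho> by (intro group_hom.intro [OF G GL_group [OF vs]] group_hom_axioms.intro)
  have mult: "\<rho> (x \<otimes>\<^bsub>G\<^esub> y) ` W \<subseteq> W"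
    if "x \<in> carrier G" "y \<in> carrier G" "\<rho> x ` W \<subseteq> W" "\<rho> y ` W \<subseteq> W" for x y
  proof -
    have "\<rho> (x \<otimes>\<^bsub>G\<^esub> y) = \<rho> x \<circ> \<rho> y" using \<rho>.hom_mult [OF that(1,2)] by simp
    then show ?thesis using that(3,4) by auto
  qed
  have one: "\<rho> \<one>\<^bsub>G\<^esub> ` W \<subseteq> W" using \<rho>.hom_one by simp
  have pow: "\<rho> (x [^]\<^bsub>G\<^esub> (n::nat)) ` W \<subseteq> W" if "x \<in> X" for x n
  proof (induction n)
    case (Suc n)
    have x: "x \<in> carrier G" using that X by blast
    show ?case using mult [OF nat_pow_closed [OF x] x Suc.IH inv [OF that]] by simp
  qed (use one in simp)
  show ?thesis
    using g
  proof (induction rule: generate.induct)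
    case (inv h)
    then have h: "h \<in> carrier G" using X by blast
    have pos: "Coset.order G > 0" using fin order_gt_0_iff_finite by simp
    have "h [^]\<^bsub>G\<^esub> (Coset.order G - 1) \<otimes>\<^bsub>G\<^esub> h = h [^]\<^bsub>G\<^esub> Suc (Coset.order G - 1)"
      by simp
    also have "\<dots> = \<one>\<^bsub>G\<^esub>" using pos pow_order_eq_1 [OF h] by simp
    finally have "inv\<^bsub>G\<^esub> h = h [^]\<^bsub>G\<^esub> (Coset.order G - 1)" using h by (intro inv_equality) auto
    then show ?case using pow [OF inv] by simp
  next
    case (eng g h)
    then have "g \<in> carrier G" "h \<in> carrier G" using generate_incl [OF X] by auto
    then show ?case using eng.IH by (rule mult)
  qed (use one inv in auto)
qed

context finite_quandle
begin

text \<open>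
  A twist changes neither the invariant subspaces nor the conjugation relations, since \<open>\<chi>\<close> is
  constant along conjugation. A subspace invariant under all \<open>\<rho> (\<psi> x)\<close> is invariant under \<open>K\<close>
  because \<open>K\<close> is finite and generated by the \<open>\<psi> x\<close>.
\<close>

lemma irreducible_twist:
  fixes scale :: "complex \<Rightarrow> 'v::ab_group_add \<Rightarrow> 'v"
  assumes vs: "vector_space scale" and \<chi>: "quandle_character Q qop \<chi>"
    and \<rho>: "irreducible_group_rep K scale \<rho>"
    and \<sigma>: "\<And>x. x \<in> Q \<Longrightarrow> \<sigma> x = twist scale \<chi> (\<rho> \<circ> \<psi>) x"
  shows "irreducible_quandle_rep Q qop scale \<sigma>"
proof -
  interpret vector_space scale by (rule vs)
  interpret GL: group "GL scale" by (rule GL_group [OF vs])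
  have \<rho>_hom: "\<rho> \<in> hom K (GL scale)" and \<rho>_irr: "irreducible_on scale (carrier K) \<rho>"
    using \<rho> by (auto simp: irreducible_group_rep_def)
  interpret \<rho>: group_hom K "GL scale" \<rho> by unfold_locales (rule \<rho>_hom)
  have \<chi>0: "\<chi> x \<noteq> 0" and \<chi>_conj: "y \<in> Q \<Longrightarrow> \<chi> (qop x y) = \<chi> y" if "x \<in> Q" for x y
    using \<chi> that by (auto simp: quandle_character_def)
  have \<sigma>_apply: "\<sigma> x v = scale (\<chi> x) (\<rho> (\<psi> x) v)" if "x \<in> Q" for x v
    by (simp add: \<sigma> [OF that] twist_def)
  have \<sigma>_closed: "\<sigma> x \<in> carrier (GL scale)" if x: "x \<in> Q" for x
  proof -
    have "\<sigma> x = (\<lambda>v. scale (\<chi> x) (\<rho> (\<psi> x) v))" using \<sigma>_apply [OF x] by blast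
    then show ?thesis using GL_scale [OF vs \<chi>0 [OF x] \<rho>.hom_closed [OF \<psi>_closed [OF x]]] by simp
  qed
  have \<rho>_scale: "\<rho> k (scale c v) = scale c (\<rho> k v)" if "k \<in> carrier K" for k c v
    using \<rho>.hom_closed [OF that] by (simp add: GL_carrier Vector_Spaces.linear_iff)
  have "\<sigma> (qop x y) = \<sigma> x \<otimes>\<^bsub>GL scale\<^esub> \<sigma> y \<otimes>\<^bsub>GL scale\<^esub> inv\<^bsub>GL scale\<^esub> (\<sigma> x)"
    if x: "x \<in> Q" and y: "y \<in> Q" for x y
  proof -
    have xy: "qop x y \<in> Q" by (rule quandle_closed [OF q x y])
    have "\<sigma> (qop x y) \<circ> \<sigma> x = \<sigma> x \<circ> \<sigma> y"
    proof
      fix v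
      have "\<rho> (\<psi> (qop x y)) \<circ> \<rho> (\<psi> x) = \<rho> (\<psi> (qop x y) \<otimes>\<^bsub>K\<^esub> \<psi> x)"
        using \<rho>.hom_mult [OF \<psi>_closed [OF xy] \<psi>_closed [OF x]] by simp
      also have "\<dots> = \<rho> (\<psi> x) \<circ> \<rho> (\<psi> y)"
        unfolding \<psi>_conj [OF x y, symmetric]
        using \<rho>.hom_mult [OF \<psi>_closed [OF x] \<psi>_closed [OF y]] by simp
      finally have "\<rho> (\<psi> (qop x y)) (\<rho> (\<psi> x) v) = \<rho> (\<psi> x) (\<rho> (\<psi> y) v)"
        by (metis comp_apply)
      then show "(\<sigma> (qop x y) \<circ> \<sigma> x) v = (\<sigma> x \<circ> \<sigma> y) v"
        by (simp add: \<sigma>_apply x y xy \<chi>_conj \<rho>_scale \<psi>_closed mult.commute)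
    qed
    then have "\<sigma> (qop x y) \<otimes>\<^bsub>GL scale\<^esub> \<sigma> x = \<sigma> x \<otimes>\<^bsub>GL scale\<^esub> \<sigma> y" by simp
    then show ?thesis
      using GL.inv_solve_right' [of "\<sigma> (qop x y)" "\<sigma> x \<otimes>\<^bsub>GL scale\<^esub> \<sigma> y" "\<sigma> x"]
        \<sigma>_closed [OF x] \<sigma>_closed [OF y] \<sigma>_closed [OF xy] GL.m_closed by metis
  qed
  then have "quandle_rep Q qop scale \<sigma>"
    using \<sigma>_closed unfolding quandle_rep_def by blast
  moreover have "irreducible_on scale Q \<sigma>"
    unfolding irreducible_on_def
  proof (intro conjI allI impI)
    show "(UNIV :: 'v set) \<noteq> {0}" using \<rho>_irr unfolding irreducible_on_def by blast
  next
    fix W assume W: "subspace W \<and> (\<forall>x\<in>Q. \<sigma> x ` W \<subseteq> W)"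
    have gen: "\<rho> k ` W \<subseteq> W" if k: "k \<in> \<psi> ` Q" for k
    proof
      fix u assume "u \<in> \<rho> k ` W"
      then obtain x w where x: "x \<in> Q" "k = \<psi> x" and w: "w \<in> W" "u = \<rho> (\<psi> x) w"
        using k by blast
      have "u = scale (inverse (\<chi> x)) (\<sigma> x w)"
        using \<chi>0 [OF x(1)] by (simp add: \<sigma>_apply [OF x(1)] w(2))
      moreover have "\<sigma> x w \<in> W" using W x(1) w(1) by blast
      ultimately show "u \<in> W" using W subspace_scale by blast
    qed
    have "\<rho> k ` W \<subseteq> W" if k: "k \<in> carrier K" for k
    proof (rule invariant_generate [OF K_group finite_K \<rho>_hom _ _ vs])
      show "\<psi> ` Q \<subseteq> carrier K" by (auto intro: \<psi>_closed)
      show "\<rho> k ` W \<subseteq> W" if "k \<in> \<psi> ` Q" for k using that by (rule gen)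
      show "k \<in> generate K (\<psi> ` Q)" using k by (simp only: K_generate [symmetric])
    qed
    then show "W = {0} \<or> W = UNIV" using W \<rho>_irr unfolding irreducible_on_def by blast
  qed
  ultimately show ?thesis by (simp add: irreducible_quandle_rep_def)
qed

text \<open>
  Extend \<open>\<sigma>\<close> to the enveloping group. Its free part \<open>F\<close> is central, so it acts through a
  character of \<open>F\<close>; dividing by an extension of this character to the whole group gives a
  representation that is trivial on \<open>F\<close>.
\<close>

lemma irreducible_untwist:
  fixes scale :: "complex \<Rightarrow> 'v::ab_group_add \<Rightarrow> 'v"
  assumes vs: "vector_space scale" and \<sigma>: "irreducible_quandle_rep Q qop scale \<sigma>"
  shows "\<exists>\<chi> \<rho>. quandle_character Q qop \<chi> \<and> irreducible_group_rep K scale \<rho> \<and>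
    (\<forall>x\<in>Q. \<sigma> x = twist scale \<chi> (\<rho> \<circ> \<psi>) x)"
proof -
  interpret vector_space scale by (rule vs)
  interpret GL: group "GL scale" by (rule GL_group [OF vs])
  have \<sigma>_closed: "\<sigma> \<in> Q \<rightarrow> carrier (GL scale)" and irr: "irreducible_on scale Q \<sigma>"
    and \<sigma>_conj: "\<And>x y. x \<in> Q \<Longrightarrow> y \<in> Q \<Longrightarrow>
      \<sigma> (qop x y) = \<sigma> x \<otimes>\<^bsub>GL scale\<^esub> \<sigma> y \<otimes>\<^bsub>GL scale\<^esub> inv\<^bsub>GL scale\<^esub> (\<sigma> x)"
    using \<sigma> by (auto simp: irreducible_quandle_rep_def quandle_rep_def)
  define R where "R = pres_lift (GL scale) \<sigma>"
  have rel: "word_eval (GL scale) \<sigma> u = word_eval (GL scale) \<sigma> v"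
    if "(u, v) \<in> env_relations Q qop" for u v
  proof -
    from that obtain x y where xy: "x \<in> Q" "y \<in> Q"
      and uv: "u = [(True, x), (True, y), (False, x)]" "v = [(True, qop x y)]"
      by (auto simp: env_relations_def)
    have "\<sigma> x \<in> carrier (GL scale)" "\<sigma> y \<in> carrier (GL scale)" "\<sigma> (qop x y) \<in> carrier (GL scale)"
      using \<sigma>_closed xy quandle_closed [OF q] by auto
    then show ?thesis
      using \<sigma>_conj [OF xy] by (simp add: uv GL.m_assoc del: GL_mult GL_one)
  qed
  have R_hom: "R \<in> hom G (GL scale)"
    unfolding R_def env_group_def by (rule pres_lift_hom [OF GL_group [OF vs] \<sigma>_closed rel])
  have R_\<phi>: "R (\<phi> x) = \<sigma> x" if "x \<in> Q" for x
    unfolding R_def env_map_def by (rule pres_lift_gen [OF GL_group [OF vs] \<sigma>_closed rel that])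
  interpret R: group_hom G "GL scale" R by unfold_locales (rule R_hom)
  have R_lin: "Vector_Spaces.linear scale scale (R g)" and R_bij: "bij (R g)"
    if "g \<in> carrier G" for g
    using R.hom_closed [OF that] by (simp_all add: GL_carrier)
  have R_mult: "R (g \<otimes>\<^bsub>G\<^esub> h) v = R g (R h v)"
    if "g \<in> carrier G" "h \<in> carrier G" for g h v
    using R.hom_mult [OF that] by simp
  have R_scale: "R g (scale c v) = scale c (R g v)" if "g \<in> carrier G" for g c v
    using R_lin [OF that] by (simp add: Vector_Spaces.linear_iff)
  have F_closed: "z \<in> carrier G" if "z \<in> F" for z using F.subset that by blast
  have scalar: "\<exists>c. \<forall>v. R z v = scale c v" if z: "z \<in> F" for z
  proof (rule schur_countable [OF vs _ _ irr])
    show "countable Q" using fin by (rule countable_finite)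
    show "Vector_Spaces.linear scale scale (\<sigma> x)" if "x \<in> Q" for x
      using \<sigma>_closed that by (auto simp: GL_carrier)
    show "Vector_Spaces.linear scale scale (R z)" by (rule R_lin [OF F_closed [OF z]])
    show "R z (\<sigma> x v) = \<sigma> x (R z v)" if x: "x \<in> Q" for x v
      using R_mult [OF F_closed [OF z] env_map_closed [OF x], of v]
        R_mult [OF env_map_closed [OF x] F_closed [OF z], of v]
        F_central [OF z env_map_closed [OF x]]
      by (simp add: R_\<phi> [OF x])
  qed
  then obtain c where c: "\<And>z v. z \<in> F \<Longrightarrow> R z v = scale (c z) v" by metis
  obtain v\<^sub>0 :: 'v where v0: "v\<^sub>0 \<noteq> 0" using irr unfolding irreducible_on_def by auto
  have c_char: "mult_char G F c"
    unfolding mult_char_def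
  proof (intro conjI ballI)
    fix z assume z: "z \<in> F"
    have "R z v\<^sub>0 \<noteq> R z 0" using bij_is_inj [OF R_bij [OF F_closed [OF z]]] v0 by (simp add: inj_eq)
    then show "c z \<noteq> 0" by (auto simp: c [OF z])
  next
    fix z z' assume z: "z \<in> F" "z' \<in> F"
    have "scale (c (z \<otimes>\<^bsub>G\<^esub> z')) v\<^sub>0 = R (z \<otimes>\<^bsub>G\<^esub> z') v\<^sub>0"
      using c [OF subgroup.m_closed [OF F_subgroup z]] by (simp only:)
    also have "\<dots> = R z (R z' v\<^sub>0)" using z by (intro R_mult F_closed)
    also have "\<dots> = scale (c z * c z') v\<^sub>0" using z by (simp add: c)
    finally have "scale (c (z \<otimes>\<^bsub>G\<^esub> z')) v\<^sub>0 = scale (c z * c z') v\<^sub>0" .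
    then show "c (z \<otimes>\<^bsub>G\<^esub> z') = c z * c z'" using v0 by simp
  qed
  have "\<exists>f. mult_char G (carrier G) f \<and> (\<forall>z\<in>F. f z = c z)"
  proof (rule G.mult_char_extend_central [OF proj.group_hom_axioms proj_surj finite_K proj_kernel])
    show "z \<otimes>\<^bsub>G\<^esub> g = g \<otimes>\<^bsub>G\<^esub> z" if "z \<in> F" "g \<in> carrier G" for z g
      using that by (rule F_central)
    show "z = \<one>\<^bsub>G\<^esub>" if "z \<in> F" "n > 0" "z [^]\<^bsub>G\<^esub> n = \<one>\<^bsub>G\<^esub>" for z and n :: nat
      using that by (rule F_torsion_free)
    show "finite (\<phi> ` Q)" using fin by simp
    show "\<phi> ` Q \<subseteq> carrier G" by (auto intro: env_map_closed)
  qed (rule env_group_generate, rule c_char)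
  then obtain f where f: "mult_char G (carrier G) f" and fc: "\<And>z. z \<in> F \<Longrightarrow> f z = c z"
    by blast
  have f0: "\<And>g. g \<in> carrier G \<Longrightarrow> f g \<noteq> 0"
    and fm: "\<And>g h. g \<in> carrier G \<Longrightarrow> h \<in> carrier G \<Longrightarrow> f (g \<otimes>\<^bsub>G\<^esub> h) = f g * f h"
    using f by (auto simp: mult_char_def)
  define \<chi> where "\<chi> x = f (\<phi> x)" for x
  have \<chi>: "quandle_character Q qop \<chi>"
    unfolding quandle_character_def
  proof (intro conjI ballI)
    fix x assume "x \<in> Q"
    then show "\<chi> x \<noteq> 0" unfolding \<chi>_def by (intro f0 env_map_closed)
  next
    fix x y assume xy: "x \<in> Q" "y \<in> Q"
    have "f (\<phi> x \<otimes>\<^bsub>G\<^esub> \<phi> y) = f (\<phi> (qop x y) \<otimes>\<^bsub>G\<^esub> \<phi> x)"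
      by (simp only: env_map_conj [OF q xy])
    then have "\<chi> x * \<chi> y = \<chi> (qop x y) * \<chi> x"
      unfolding \<chi>_def using xy quandle_closed [OF q xy] by (simp add: fm env_map_closed)
    then show "\<chi> (qop x y) = \<chi> y" using f0 [OF env_map_closed [OF xy(1)]] by (simp add: \<chi>_def)
  qed
  define P where "P g v = scale (inverse (f g)) (R g v)" for g v
  have P_closed: "P g \<in> carrier (GL scale)" if "g \<in> carrier G" for g
    unfolding P_def using GL_scale [OF vs _ R.hom_closed [OF that]] f0 [OF that] by simp
  have P_mult: "P (g \<otimes>\<^bsub>G\<^esub> h) = P g \<circ> P h" if "g \<in> carrier G" "h \<in> carrier G" for g h
    using that by (auto simp: P_def R_mult R_scale fm)
  have P_F: "P z = id" if "z \<in> F" for z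
  proof
    fix v
    show "P z v = id v" using f0 [OF F_closed [OF that]] by (simp add: P_def c that fc)
  qed
  \<comment> \<open>\<open>P\<close> is constant on the cosets of \<open>F\<close>, so any representative defines \<open>\<rho>\<close>.\<close>
  define \<rho> where "\<rho> k = P (SOME g. g \<in> carrier G \<and> proj g = k)" for k
  have \<rho>_proj: "\<rho> (proj g) = P g" if g: "g \<in> carrier G" for g
  proof -
    define h where "h = (SOME h. h \<in> carrier G \<and> proj h = proj g)"
    have h: "h \<in> carrier G" "proj h = proj g"
      unfolding h_def using someI [of "\<lambda>h. h \<in> carrier G \<and> proj h = proj g" g] g by auto
    have "h \<otimes>\<^bsub>G\<^esub> inv\<^bsub>G\<^esub> g \<in> kernel G K proj"
      using h g by (simp add: kernel_def)
    then have z: "h \<otimes>\<^bsub>G\<^esub> inv\<^bsub>G\<^esub> g \<in> F" by (simp only: proj_kernel)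
    have "h = (h \<otimes>\<^bsub>G\<^esub> inv\<^bsub>G\<^esub> g) \<otimes>\<^bsub>G\<^esub> g" using h g by (simp add: G.m_assoc)
    then have "P h = P (h \<otimes>\<^bsub>G\<^esub> inv\<^bsub>G\<^esub> g) \<circ> P g" using P_mult [OF F_closed [OF z] g] by simp
    then show ?thesis by (simp add: \<rho>_def P_F [OF z] flip: h_def)
  qed
  have \<rho>_hom: "\<rho> \<in> hom K (GL scale)"
  proof (rule homI)
    fix k assume "k \<in> carrier K"
    then have "k \<in> proj ` carrier G" by (simp only: proj_surj)
    then obtain g where "g \<in> carrier G" "k = proj g" by (elim imageE)
    then show "\<rho> k \<in> carrier (GL scale)" by (simp add: \<rho>_proj P_closed)
  next
    fix k l assume "k \<in> carrier K" "l \<in> carrier K"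
    then have "k \<in> proj ` carrier G" "l \<in> proj ` carrier G" by (simp_all only: proj_surj)
    then obtain g h where gh: "g \<in> carrier G" "k = proj g" "h \<in> carrier G" "l = proj h"
      by (elim imageE)
    have "\<rho> (k \<otimes>\<^bsub>K\<^esub> l) = \<rho> (proj (g \<otimes>\<^bsub>G\<^esub> h))"
      unfolding gh(2,4) by (simp only: proj.hom_mult [OF gh(1,3)])
    also have "\<dots> = P g \<circ> P h"
      by (simp only: \<rho>_proj [OF G.m_closed [OF gh(1,3)]] P_mult [OF gh(1,3)])
    also have "\<dots> = \<rho> k \<otimes>\<^bsub>GL scale\<^esub> \<rho> l" using gh by (simp add: \<rho>_proj)
    finally show "\<rho> (k \<otimes>\<^bsub>K\<^esub> l) = \<rho> k \<otimes>\<^bsub>GL scale\<^esub> \<rho> l" .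
  qed
  have \<sigma>_eq: "\<sigma> x v = scale (\<chi> x) (\<rho> (\<psi> x) v)" if x: "x \<in> Q" for x v
    using f0 [OF env_map_closed [OF x]]
    by (simp add: \<psi> \<rho>_proj env_map_closed x P_def \<chi>_def R_\<phi>)
  have "irreducible_on scale (carrier K) \<rho>"
    unfolding irreducible_on_def
  proof (intro conjI allI impI)
    show "(UNIV :: 'v set) \<noteq> {0}" using v0 by auto
  next
    fix W assume W: "subspace W \<and> (\<forall>k\<in>carrier K. \<rho> k ` W \<subseteq> W)"
    have "\<sigma> x ` W \<subseteq> W" if x: "x \<in> Q" for x
    proof -
      have "\<rho> (\<psi> x) w \<in> W" if "w \<in> W" for w using W \<psi>_closed [OF x] that by blast
      then show ?thesis using W subspace_scale by (auto simp: \<sigma>_eq [OF x])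
    qed
    then show "W = {0} \<or> W = UNIV" using W irr unfolding irreducible_on_def by blast
  qed
  then have "irreducible_group_rep K scale \<rho>" using \<rho>_hom by (simp add: irreducible_group_rep_def)
  moreover have "\<sigma> x = twist scale \<chi> (\<rho> \<circ> \<psi>) x" if "x \<in> Q" for x
    using \<sigma>_eq [OF that] by (auto simp: twist_def)
  ultimately show ?thesis using \<chi> by blast
qed

end

theorem theorem3p6:
  fixes Q :: "'a set" and qop :: "'a \<Rightarrow> 'a \<Rightarrow> 'a"
    and \<alpha> :: "'a gword set \<times> 'a gword set set \<Rightarrow> 'a gword set"
    and scale :: "complex \<Rightarrow> 'v::ab_group_add \<Rightarrow> 'v"
  assumes "quandle Q qop" and "finite Q"
    and "\<alpha> \<in> iso (Tor (Z0 Q qop) \<times>\<times> (Z0 Q qop Mod torsion_part (Z0 Q qop))) (Z0 Q qop)"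
    and "vector_space scale"
  shows "finite (carrier (finite_env_group Q qop \<alpha>)) \<and>
    (\<forall>\<sigma>. irreducible_quandle_rep Q qop scale \<sigma> \<longleftrightarrow>
      (\<exists>\<chi> \<rho>. quandle_character Q qop \<chi> \<and>
        irreducible_group_rep (finite_env_group Q qop \<alpha>) scale \<rho> \<and>
        (\<forall>x\<in>Q. \<sigma> x = twist scale \<chi> (\<rho> \<circ> finite_env_map Q qop \<alpha>) x)))"
proof -
  interpret finite_quandle Q qop \<alpha> using assms(1-3) by (rule finite_quandle.intro)
  show ?thesis
    using finite_K irreducible_twist [OF assms(4)] irreducible_untwist [OF assms(4)]
    by (intro conjI allI iffI) blast+
qed

end
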